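(* Let $d\ge1$ and let $w\in L^1(\mathbb{R}^d)+L^\infty(\mathbb{R}^d)$ be a positive radial non-increasing function. Then, for $T=0$ and all $\rho\ge0$, the no-spin minimisation problem $E^{\rm HF}_{\text{no-spin}}(\rho,0)$ has a unique minimiser $g_{\rho,0}$, given by $$g_{\rho,0}(k)=\mathbf{1}\big(k^2\le c_{\rm TF}\,\rho^{2/d}\big),\qquad c_{\rm TF}:=4\pi^2\left(\frac{d}{|\mathbb{S}^{d-1}|}\right)^{2/d}.$$
   Context: The no-spin problem at $T=0$ is $$E^{\rm HF}_{\text{no-spin}}(\rho,0)=\min\Big\{\frac{1}{2(2\pi)^d}\int_{\mathbb{R}^d}|k|^2g(k)\,dk-\frac{1}{2(2\pi)^d}\iint_{\mathbb{R}^d\times\mathbb{R}^d}w(k-k')g(k)g(k')\,dk\,dk'\Big\},$$ the minimum being over measurable $g:\mathbb{R}^d\to[0,1]$ with $(2\pi)^{-d}\int_{\mathbb{R}^d}g=\rho$. Functions are identified when they agree almost everywhere. $|\mathbb{S}^{d-1}|$ is the surface measure of the unit sphere (with $|\mathbb{S}^0|=2$), and $\mathbf 1(\cdot)$ is the indicator function. *)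

theory Defs
  imports "HOL-Analysis.Analysis"
begin

text \<open>
  The space \<open>\<real>\<^sup>d\<close> is a Euclidean space \<open>'a\<close> with \<open>d = DIM('a)\<close>. Functions are represented by
  pointwise defined Lebesgue measurable ones, and equality of functions is equality almost
  everywhere.
\<close>

definition L1_plus_Linf :: "('a::euclidean_space \<Rightarrow> real) \<Rightarrow> bool" where
  "L1_plus_Linf w \<longleftrightarrow> (\<exists>u v.
      integrable lebesgue u \<and>
      v \<in> borel_measurable lebesgue \<and> (\<exists>C. AE k in lebesgue. \<bar>v k\<bar> \<le> C) \<and>
      (AE k in lebesgue. w k = u k + v k))"

text \<open>
  The profile is not constrained at radius \<open>0\<close>, where a singular potential such as
  \<open>k \<mapsto> 1 / \<bar>k\<bar>\<^sup>2\<close> has an arbitrary real value.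
\<close>

definition radial_nonincreasing :: "('a::euclidean_space \<Rightarrow> real) \<Rightarrow> bool" where
  "radial_nonincreasing w \<longleftrightarrow>
     (\<exists>\<phi>::real \<Rightarrow> real. antimono_on {0<..} \<phi> \<and> (AE k in lebesgue. w k = \<phi> (norm k)))"

definition admissible :: "real \<Rightarrow> ('a::euclidean_space \<Rightarrow> real) set" where
  "admissible \<rho> = {g. g \<in> borel_measurable lebesgue \<and> (\<forall>k. 0 \<le> g k \<and> g k \<le> 1) \<and>
      integrable lebesgue g \<and> 1 / (2 * pi) ^ DIM('a) * (LINT k|lebesgue. g k) = \<rho>}"

text \<open>
  The kinetic integral may be infinite. The exchange integral is a genuine (finite) one for
  admissible \<open>g\<close> and \<open>w \<in> L\<^sup>1 + L\<^sup>\<infinity>\<close>, so the difference is never of the form \<open>\<infinity> - \<infinity>\<close>.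
\<close>

definition HF_energy :: "('a::euclidean_space \<Rightarrow> real) \<Rightarrow> ('a \<Rightarrow> real) \<Rightarrow> ereal" where
  "HF_energy w g =
     ereal (1 / (2 * (2 * pi) ^ DIM('a))) *
       enn2ereal (\<integral>\<^sup>+ k. ennreal ((norm k)\<^sup>2 * g k) \<partial>lebesgue)
     - ereal (1 / (2 * (2 * pi) ^ DIM('a)) *
       (LINT p|(lebesgue :: ('a \<times> 'a) measure). w (fst p - snd p) * g (fst p) * g (snd p)))"

definition E_HF_no_spin :: "('a::euclidean_space \<Rightarrow> real) \<Rightarrow> real \<Rightarrow> ereal" where
  "E_HF_no_spin w \<rho> = (INF g\<in>admissible \<rho>. HF_energy w g)"

definition is_no_spin_minimiser ::
    "('a::euclidean_space \<Rightarrow> real) \<Rightarrow> real \<Rightarrow> ('a \<Rightarrow> real) \<Rightarrow> bool" where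
  "is_no_spin_minimiser w \<rho> g \<longleftrightarrow> g \<in> admissible \<rho> \<and> HF_energy w g = E_HF_no_spin w \<rho>"

text \<open>
  Surface measure of a compact smooth hypersurface, as the Minkowski content of codimension one:
  the limit of the volume of the tube of radius \<open>\<epsilon>\<close>, divided by its width \<open>2\<epsilon>\<close>.
\<close>

definition surface_measure :: "'a::euclidean_space set \<Rightarrow> real" where
  "surface_measure S =
     Lim (at_right 0) (\<lambda>\<epsilon>::real. measure lebesgue {x. infdist x S < \<epsilon>} / (2 * \<epsilon>))"

definition c_TF :: "'a::euclidean_space itself \<Rightarrow> real" where
  "c_TF _ = 4 * pi\<^sup>2 *
     (real DIM('a) / surface_measure (sphere (0::'a) 1)) powr (2 / real DIM('a))"

definition g_TF :: "real \<Rightarrow> 'a::euclidean_space \<Rightarrow> real" where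
  "g_TF \<rho> = indicator {k. (norm k)\<^sup>2 \<le> c_TF TYPE('a) * \<rho> powr (2 / real DIM('a))}"

text \<open>The limit exists for the unit sphere and has the usual value.\<close>

lemma tube_unit_sphere:
  assumes "0 < e" "e < 1"
  shows "{x::'a::euclidean_space. infdist x (sphere 0 1) < e} = ball 0 (1 + e) - cball 0 (1 - e)"
proof (intro equalityI subsetI)
  fix x :: 'a
  assume "x \<in> {x. infdist x (sphere 0 1) < e}"
  moreover have "sphere (0::'a) 1 \<noteq> {}" by simp
  moreover have "closed (sphere (0::'a) 1)" by simp
  ultimately obtain y :: 'a where y: "norm y = 1" "dist x y < e"
    by (metis infdist_attains_inf mem_Collect_eq mem_sphere_0)
  have "norm x \<le> norm y + dist x y" "norm y \<le> norm x + dist x y"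
    by norm+
  then show "x \<in> ball 0 (1 + e) - cball 0 (1 - e)"
    using y by simp
next
  fix x :: 'a
  assume "x \<in> ball 0 (1 + e) - cball 0 (1 - e)"
  then have x: "1 - e < norm x" "norm x < 1 + e" by auto
  then have nz: "norm x > 0" using assms by linarith
  define y where "y = x /\<^sub>R norm x"
  have "x - y = (1 - 1 / norm x) *\<^sub>R x"
    by (simp add: y_def algebra_simps inverse_eq_divide)
  then have "dist x y = \<bar>1 - 1 / norm x\<bar> * norm x"
    by (simp add: dist_norm)
  also have "\<dots> = \<bar>(1 - 1 / norm x) * norm x\<bar>"
    by (simp only: abs_mult abs_norm_cancel)
  also have "\<dots> = \<bar>norm x - 1\<bar>"
    using nz by (simp add: left_diff_distrib)
  finally have "dist x y < e" using x by linarith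
  moreover have "y \<in> sphere 0 1" using nz by (simp add: y_def)
  ultimately show "x \<in> {x. infdist x (sphere 0 1) < e}"
    using infdist_le[of y "sphere 0 1" x] by simp
qed

lemma tendsto_tube_unit_sphere:
  "((\<lambda>\<epsilon>::real. measure lebesgue {x::'a::euclidean_space. infdist x (sphere 0 1) < \<epsilon>} / (2 * \<epsilon>))
     \<longlongrightarrow> real DIM('a) * unit_ball_vol (real DIM('a))) (at_right 0)"
proof -
  let ?d = "DIM('a)" and ?v = "unit_ball_vol (real DIM('a))"
  let ?q = "\<lambda>e::real. ?v * ((((1 + e) ^ ?d - (1 - e) ^ ?d) - 0) / (e - 0)) / 2"
  have "((\<lambda>e::real. (1 + e) ^ ?d - (1 - e) ^ ?d) has_real_derivative 2 * real ?d) (at 0)"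
    by (auto intro!: derivative_eq_intros)
  then have "((\<lambda>e::real. (((1 + e) ^ ?d - (1 - e) ^ ?d) - 0) / (e - 0)) \<longlongrightarrow> 2 * real ?d) (at 0)"
    by (simp add: has_field_derivative_iff)
  then have "(?q \<longlongrightarrow> ?v * (2 * real ?d) / 2) (at 0)"
    by (intro tendsto_intros) auto
  then have "(?q \<longlongrightarrow> real ?d * ?v) (at_right 0)"
    by (auto simp: mult_ac intro: filterlim_mono[OF _ order_refl at_le])
  moreover have "\<forall>\<^sub>F e in at_right 0.
      measure lebesgue {x::'a. infdist x (sphere 0 1) < e} / (2 * e) = ?q e"
    unfolding eventually_at_right_field
  proof (intro exI[of _ 1] conjI allI impI)
    fix e :: real
    assume e: "0 < e" "e < 1"
    have "measure lebesgue {x::'a. infdist x (sphere 0 1) < e}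
        = measure lebesgue (ball (0::'a) (1 + e)) - measure lebesgue (cball (0::'a) (1 - e))"
      using e unfolding tube_unit_sphere[OF e]
      by (intro measurable_measure_Diff) auto
    also have "\<dots> = ?v * ((1 + e) ^ ?d - (1 - e) ^ ?d)"
      using e content_ball[of "1 + e" "0::'a"] content_cball[of "1 - e" "0::'a"]
      by (simp add: right_diff_distrib)
    finally show "measure lebesgue {x::'a. infdist x (sphere 0 1) < e} / (2 * e) = ?q e"
      by simp
  qed simp
  ultimately show ?thesis
    by (rule Lim_transform_eventually[OF _ eventually_mono]) simp
qed

lemma surface_measure_unit_sphere:
  "surface_measure (sphere (0::'a::euclidean_space) 1)
     = 2 * pi powr (real DIM('a) / 2) / Gamma (real DIM('a) / 2)"
proof -
  have sm: "surface_measure (sphere (0::'a) 1) = real DIM('a) * unit_ball_vol (real DIM('a))"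
    unfolding surface_measure_def by (intro tendsto_Lim tendsto_tube_unit_sphere) simp
  have "real DIM('a) / 2 \<notin> \<int>\<^sub>\<le>\<^sub>0"
    using DIM_positive[where 'a = 'a] by (auto dest: nonpos_Ints_nonpos)
  then have gm: "Gamma (real DIM('a) / 2 + 1) = real DIM('a) / 2 * Gamma (real DIM('a) / 2)"
    by (rule Gamma_plus1)
  have "real DIM('a) * unit_ball_vol (real DIM('a))
     = 2 * pi powr (real DIM('a) / 2) / Gamma (real DIM('a) / 2)"
    unfolding unit_ball_vol_def gm by simp
  with sm show ?thesis by (rule trans)
qed

lemma surface_measure_unit_sphere_1:
  "DIM('a::euclidean_space) = 1 \<Longrightarrow> surface_measure (sphere (0::'a) 1) = 2"
  by (simp add: surface_measure_unit_sphere Gamma_one_half_real powr_half_sqrt)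

end

theory Submission
  imports Defs
begin

text \<open>
  Both terms of the energy are optimised by the centred ball \<open>B\<close> of measure \<open>(2 \<pi>)\<^sup>d \<rho>\<close>. For the
  kinetic term this is the bathtub principle, which also gives uniqueness. For the exchange term,
  let \<open>\<sigma>\<close> be the reflection in a hyperplane and, on every pair \<open>x, \<sigma> x\<close>, move as much
  mass of \<open>g\<close> as possible to the point closer to the origin. This does not decrease
  the exchange integral. It increases the mass of \<open>g\<close> in \<open>B\<close> by at least
  \<open>\<integral> (1 - g x) g (\<sigma> x) dx\<close> over the \<open>x \<in> B\<close> with \<open>\<sigma> x \<notin> B\<close>, and averaging over all hyperplanes
  that meet a bounded region bounds the best gain from below as long as a fixed amount of mass
  lies outside \<open>B\<close>. So finitely many reflections bring \<open>g\<close> arbitrarily close to the indicator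
  of \<open>B\<close> in \<open>L\<^sup>1\<close>, where the exchange integral is continuous because the potential of \<open>w\<close> is bounded.
\<close>


subsection \<open>Reflections in hyperplanes\<close>

text \<open>For finitely many steps to suffice, the gain of one step must be bounded below uniformly
  over all functions that the iteration may reach. Averaging gives such a bound only for mass in a
  fixed bounded region. One region serves all steps, because pushing never removes mass from a
  centred ball: a ball carrying almost all the mass of the initial function keeps doing so. Mirrors
  through the origin move nothing, hence the offset \<open>s\<close>. The normal \<open>v\<close> is
  not normalised, so that the pairs \<open>(v, s)\<close> fill a Euclidean space and the averages
  are plain Lebesgue integrals with affine substitutions; for \<open>v = 0\<close> the formula gives
  the identity. The kinetic integral may be infinite, and so may the kernel at the origin.
  Inequalities are therefore stated in \<open>ennreal\<close> with negative terms moved to the other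
  side, and finiteness is established before anything is cancelled.\<close>

definition hrefl :: "'a::euclidean_space \<Rightarrow> real \<Rightarrow> 'a \<Rightarrow> 'a" where
  "hrefl v s x = x - (2 * (x \<bullet> v - s) / (v \<bullet> v)) *\<^sub>R v"

lemma borel_measurable_hrefl [measurable]:
  assumes [measurable]: "v \<in> borel_measurable M" "s \<in> borel_measurable M" "f \<in> borel_measurable M"
  shows "(\<lambda>x. hrefl (v x) (s x) (f x) :: 'a::euclidean_space) \<in> borel_measurable M"
  unfolding hrefl_def by measurable

lemma hrefl_side:
  "v \<noteq> 0 \<Longrightarrow> hrefl v s x \<bullet> v - s = - (x \<bullet> v - s)"
  by (simp add: hrefl_def inner_diff_left)

lemma hrefl_invol [simp]: "hrefl v s (hrefl v s x) = x"
proof (cases "v = 0")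
  case False
  then show ?thesis
    unfolding hrefl_def[of v s "hrefl v s x"] hrefl_side[OF False, of s x]
    by (simp add: hrefl_def diff_divide_distrib flip: scaleR_minus_left)
qed (simp add: hrefl_def)

text \<open>The last term is nonnegative exactly when \<open>x\<close> and \<open>y\<close> are not
  strictly separated by the mirror; reflecting \<open>y\<close> then does not bring it closer to
  \<open>x\<close>. With \<open>x = 0\<close> this tells which point of a mirror pair is closer to
  the origin.\<close>

lemma norm_diff_hrefl:
  "(norm (x - hrefl v s y))\<^sup>2 = (norm (x - y))\<^sup>2 + 4 * (x \<bullet> v - s) * (y \<bullet> v - s) / (v \<bullet> v)"
proof (cases "v = 0")
  case False
  then have v: "v \<bullet> v \<noteq> 0" by simp
  define c where "c = 2 * (y \<bullet> v - s) / (v \<bullet> v)"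
  have c: "c * (v \<bullet> v) = 2 * (y \<bullet> v - s)" using v by (simp add: c_def)
  have "(norm (x - hrefl v s y))\<^sup>2 = (norm (x - y))\<^sup>2 + 2 * c * ((x - y) \<bullet> v) + c * (c * (v \<bullet> v))"
    unfolding hrefl_def c_def[symmetric] power2_norm_eq_inner
    by (simp add: algebra_simps inner_commute)
  also have "\<dots> = (norm (x - y))\<^sup>2 + 2 * c * (x \<bullet> v - s)"
    unfolding c by (simp add: algebra_simps)
  finally show ?thesis by (simp add: c_def algebra_simps)
qed (simp add: hrefl_def)

lemma hrefl_diff: "hrefl v s x - hrefl v s y = hrefl v 0 (x - y)"
  by (simp add: hrefl_def algebra_simps diff_divide_distrib)

lemma norm_hrefl_0 [simp]: "norm (hrefl v 0 x) = norm x"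
  using norm_diff_hrefl[of 0 v 0 x] by simp

lemma dist_hrefl: "dist (hrefl v s x) (hrefl v s y) = dist x y"
  by (simp add: dist_norm hrefl_diff)

section \<open>Invariance of Lebesgue measure under reflections\<close>

lemma nn_integral_lborel_affine:
  fixes f :: "'a::euclidean_space \<Rightarrow> ennreal"
  assumes [measurable]: "f \<in> borel_measurable borel" and "c \<noteq> 0"
  shows "(\<integral>\<^sup>+x. f x \<partial>lborel) = ennreal (\<bar>c\<bar> ^ DIM('a)) * (\<integral>\<^sup>+x. f (t + c *\<^sub>R x) \<partial>lborel)"
  by (subst lborel_affine[OF \<open>c \<noteq> 0\<close>, of t])
     (simp add: nn_integral_density nn_integral_distr nn_integral_cmult)

lemma nn_integral_lborel_shift:
  fixes f :: "'a::euclidean_space \<Rightarrow> ennreal"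
  assumes [measurable]: "f \<in> borel_measurable borel"
  shows "(\<integral>\<^sup>+x. f (t + x) \<partial>lborel) = (\<integral>\<^sup>+x. f x \<partial>lborel)"
    and "(\<integral>\<^sup>+x. f (t - x) \<partial>lborel) = (\<integral>\<^sup>+x. f x \<partial>lborel)"
  using nn_integral_lborel_affine[of f 1 t] nn_integral_lborel_affine[of f "-1" t] by simp_all

text \<open>The uniqueness argument for Haar measure, with a unit ball as test set.\<close>

lemma emeasure_hrefl_vimage:
  fixes A :: "'a::euclidean_space set"
  assumes [measurable]: "A \<in> sets borel"
  shows "emeasure lborel (hrefl v s -` A) = emeasure lborel A"
proof -
  \<comment> \<open>Centred at the image of \<open>0\<close>, the test ball has the unit ball at
    \<open>0\<close> as its preimage. Both have the same volume, which forces the Haar constant to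
    be 1.\<close>
  let ?r = "hrefl v s" and ?C = "cball (hrefl v s 0) 1"
  have [measurable]: "?C \<in> sets borel"
    by simp
  have C: "emeasure lborel (?r -` ?C) = emeasure lborel ?C"
  proof -
    have "?r -` ?C = cball 0 1"
      using dist_hrefl[of v s 0] by (auto simp: mem_cball)
    then show ?thesis by (simp add: emeasure_cball)
  qed
  have pre [measurable]: "?r -` B \<in> sets borel" if [measurable]: "B \<in> sets borel" for B
    by (rule measurable_sets_borel[OF _ that]) measurable
  have "emeasure lborel (?r -` A) * emeasure lborel ?C
      = (\<integral>\<^sup>+x. \<integral>\<^sup>+y. indicator A (?r x) * indicator ?C (?r x + y) \<partial>lborel \<partial>lborel)"
  proof -
    have "(\<integral>\<^sup>+y. indicator A (?r x) * indicator ?C (?r x + y) \<partial>lborel)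
        = indicator (?r -` A) x * emeasure lborel ?C" for x
    proof -
      have "(\<integral>\<^sup>+y. indicator A (?r x) * indicator ?C (?r x + y) \<partial>lborel)
        = indicator A (?r x) * (\<integral>\<^sup>+y. indicator ?C (?r x + y) \<partial>lborel)"
        by (rule nn_integral_cmult) simp
      also have "(\<integral>\<^sup>+y. indicator ?C (?r x + y) \<partial>lborel) = emeasure lborel ?C"
        by (subst nn_integral_lborel_shift(1)) simp_all
      finally show ?thesis by (simp add: indicator_def)
    qed
    then show ?thesis by (simp add: nn_integral_multc)
  qed
  also have "\<dots> = (\<integral>\<^sup>+y. \<integral>\<^sup>+x. indicator A (?r x) * indicator ?C (?r x + y) \<partial>lborel \<partial>lborel)"
    by (rule lborel_pair.Fubini'[symmetric]) simp
  \<comment> \<open>Translating \<open>x\<close> by \<open>- hrefl v 0 y\<close> translates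
    \<open>?r x\<close> by \<open>- y\<close>, which moves the shift from \<open>?C\<close> to
    \<open>A\<close>.\<close>
  also have "\<dots> = (\<integral>\<^sup>+y. \<integral>\<^sup>+x. indicator A (?r x - y) * indicator ?C (?r x) \<partial>lborel \<partial>lborel)"
  proof (rule nn_integral_cong)
    fix y :: 'a
    have "hrefl v 0 (- hrefl v 0 y) = - y"
      using hrefl_diff[of v 0 0 "hrefl v 0 y"] by (simp add: hrefl_def[of v 0 0])
    then have "?r (- hrefl v 0 y + x) = ?r x - y" for x
      using hrefl_diff[of v s "- hrefl v 0 y + x" x] by (simp add: algebra_simps)
    then show "(\<integral>\<^sup>+x. indicator A (?r x) * indicator ?C (?r x + y) \<partial>lborel)
        = (\<integral>\<^sup>+x. indicator A (?r x - y) * indicator ?C (?r x) \<partial>lborel)"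
      using nn_integral_lborel_shift(1)[of "\<lambda>x. indicator A (?r x) * indicator ?C (?r x + y)" "- hrefl v 0 y"]
      by simp
  qed
  also have "\<dots> = (\<integral>\<^sup>+x. \<integral>\<^sup>+y. indicator A (?r x - y) * indicator ?C (?r x) \<partial>lborel \<partial>lborel)"
    by (rule lborel_pair.Fubini') simp
  also have "\<dots> = emeasure lborel A * emeasure lborel (?r -` ?C)"
  proof -
    have "(\<integral>\<^sup>+y. indicator A (?r x - y) * indicator ?C (?r x) \<partial>lborel)
        = emeasure lborel A * indicator (?r -` ?C) x" for x
    proof -
      have "(\<integral>\<^sup>+y. indicator A (?r x - y) * indicator ?C (?r x) \<partial>lborel)
        = (\<integral>\<^sup>+y. indicator A (?r x - y) \<partial>lborel) * indicator ?C (?r x)"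
        by (rule nn_integral_multc) simp
      also have "(\<integral>\<^sup>+y. indicator A (?r x - y) \<partial>lborel) = emeasure lborel A"
        by (subst nn_integral_lborel_shift(2)) simp_all
      finally show ?thesis by (simp add: indicator_def)
    qed
    then show ?thesis by (simp add: nn_integral_cmult)
  qed
  finally have "emeasure lborel (?r -` A) * emeasure lborel ?C = emeasure lborel A * emeasure lborel ?C"
    unfolding C .
  moreover have "emeasure lborel ?C \<noteq> 0" "emeasure lborel ?C \<noteq> \<infinity>"
    using unit_ball_vol_pos[of "real DIM('a)"] by (auto simp: emeasure_cball simp del: unit_ball_vol_pos)
  ultimately show ?thesis
    by (auto simp: mult.commute[of _ "emeasure lborel (cball (hrefl v s 0) 1)"] ennreal_mult_cancel_left)
qed

lemma distr_hrefl: "distr lborel borel (hrefl v s) = lborel"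
  by (rule measure_eqI) (simp_all add: emeasure_distr emeasure_hrefl_vimage)

lemma nn_integral_hrefl:
  assumes [measurable]: "f \<in> borel_measurable borel"
  shows "(\<integral>\<^sup>+x. f (hrefl v s x) \<partial>lborel) = (\<integral>\<^sup>+x. f x \<partial>lborel)"
  by (subst (2) distr_hrefl[of v s, symmetric]) (simp add: nn_integral_distr)

text \<open>By invariance, twice each integral is the integral of the sums over mirror pairs, so a
  comparison pair by pair suffices. This is how a function is compared with its
  \<open>push\<close>.\<close>

lemma nn_integral_mono_hrefl:
  fixes F G :: "'a::euclidean_space \<Rightarrow> ennreal"
  assumes [measurable]: "F \<in> borel_measurable borel" "G \<in> borel_measurable borel"
    and le: "\<And>x. F x + F (hrefl v s x) \<le> G x + G (hrefl v s x)"
  shows "(\<integral>\<^sup>+x. F x \<partial>lborel) \<le> (\<integral>\<^sup>+x. G x \<partial>lborel)"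
proof -
  have "2 * (\<integral>\<^sup>+x. F x \<partial>lborel) = (\<integral>\<^sup>+x. F x + F (hrefl v s x) \<partial>lborel)"
    by (simp add: nn_integral_add nn_integral_hrefl mult_2)
  also have "\<dots> \<le> (\<integral>\<^sup>+x. G x + G (hrefl v s x) \<partial>lborel)"
    by (intro nn_integral_mono le)
  also have "\<dots> = 2 * (\<integral>\<^sup>+x. G x \<partial>lborel)"
    by (simp add: nn_integral_add nn_integral_hrefl mult_2)
  finally show ?thesis
    by (simp add: ennreal_mult_le_mult_iff)
qed


text \<open>The unit of comparison is now the orbit of four points that arises when each variable is
  reflected separately.\<close>

lemma nn_integral_mono_hrefl2:
  fixes F G :: "'a::euclidean_space \<Rightarrow> 'a \<Rightarrow> ennreal"
  assumes [measurable]: "case_prod F \<in> borel_measurable (borel \<Otimes>\<^sub>M borel)"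
    "case_prod G \<in> borel_measurable (borel \<Otimes>\<^sub>M borel)"
    and le: "\<And>x y. F x y + F (hrefl v s x) y + (F x (hrefl v s y) + F (hrefl v s x) (hrefl v s y))
      \<le> G x y + G (hrefl v s x) y + (G x (hrefl v s y) + G (hrefl v s x) (hrefl v s y))"
  shows "(\<integral>\<^sup>+x. \<integral>\<^sup>+y. F x y \<partial>lborel \<partial>lborel) \<le> (\<integral>\<^sup>+x. \<integral>\<^sup>+y. G x y \<partial>lborel \<partial>lborel)"
proof (rule nn_integral_mono_hrefl[where v = v and s = s])
  fix x
  have "(\<integral>\<^sup>+y. F x y + F (hrefl v s x) y \<partial>lborel) \<le> (\<integral>\<^sup>+y. G x y + G (hrefl v s x) y \<partial>lborel)"
    by (rule nn_integral_mono_hrefl[where v = v and s = s]) (simp_all add: le)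
  then show "(\<integral>\<^sup>+y. F x y \<partial>lborel) + (\<integral>\<^sup>+y. F (hrefl v s x) y \<partial>lborel)
      \<le> (\<integral>\<^sup>+y. G x y \<partial>lborel) + (\<integral>\<^sup>+y. G (hrefl v s x) y \<partial>lborel)"
    by (simp add: nn_integral_add)
qed simp_all

subsection \<open>Pushing mass towards the origin\<close>

text \<open>
  On each pair of mirror points, the mass is moved to the point closer to the origin as far as the
  constraint \<open>g \<le> 1\<close> permits. Unlike the usual polarization (maximum and minimum of the two
  values), this drives \<open>g\<close> to the indicator function of a ball, not just to its rearrangement.
\<close>

definition push :: "'a::euclidean_space \<Rightarrow> real \<Rightarrow> ('a \<Rightarrow> real) \<Rightarrow> 'a \<Rightarrow> real" where
  "push v s g x =
    (let y = hrefl v s x in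
     if norm x < norm y then min 1 (g x + g y)
     else if norm y < norm x then max 0 (g x + g y - 1)
     else g x)"

text \<open>Borel rather than Lebesgue measurability makes composition with \<open>hrefl\<close> and
  products of functions of different variables measurable at once;
  \<open>admissible_borel_profile\<close> passes to this class.\<close>

definition profile :: "('a::euclidean_space \<Rightarrow> real) \<Rightarrow> bool" where
  "profile g \<longleftrightarrow> g \<in> borel_measurable borel \<and> (\<forall>x. 0 \<le> g x \<and> g x \<le> 1)"

lemma profileD:
  assumes "profile g"
  shows "g \<in> borel_measurable borel" "0 \<le> g x" "g x \<le> 1"
  using assms by (auto simp: profile_def)

lemma push_sum: "push v s g x + push v s g (hrefl v s x) = g x + g (hrefl v s x)"
  by (auto simp: push_def Let_def)

lemma profile_push:
  assumes "profile g"
  shows "profile (push v s g)"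
proof -
  note [measurable] = profileD(1)[OF assms]
  have "push v s g \<in> borel_measurable borel"
    unfolding push_def[abs_def] Let_def by measurable
  moreover have "0 \<le> push v s g x \<and> push v s g x \<le> 1" for x
    using profileD(2,3)[OF assms, of x] profileD(2,3)[OF assms, of "hrefl v s x"]
    by (auto simp: push_def Let_def)
  ultimately show ?thesis by (simp add: profile_def)
qed

lemma nn_integral_push:
  assumes "profile g"
  shows "(\<integral>\<^sup>+x. ennreal (push v s g x) \<partial>lborel) = (\<integral>\<^sup>+x. ennreal (g x) \<partial>lborel)"
proof (rule antisym)
  note p = profile_push[OF assms, of v s]
  note [measurable] = profileD(1)[OF assms] profileD(1)[OF p]
  have eq: "ennreal (push v s g x) + ennreal (push v s g (hrefl v s x))
      = ennreal (g x) + ennreal (g (hrefl v s x))" for x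
    using push_sum[of v s g x] profileD(2)[OF assms] profileD(2)[OF p]
    by (simp flip: ennreal_plus)
  show "(\<integral>\<^sup>+x. ennreal (push v s g x) \<partial>lborel) \<le> (\<integral>\<^sup>+x. ennreal (g x) \<partial>lborel)"
    "(\<integral>\<^sup>+x. ennreal (g x) \<partial>lborel) \<le> (\<integral>\<^sup>+x. ennreal (push v s g x) \<partial>lborel)"
    by (rule nn_integral_mono_hrefl[where v = v and s = s]; simp add: eq)+
qed

text \<open>Pairs with both points inside, or both outside, contribute the same before and after the
  push, as their sums are kept. Only pairs straddling the sphere matter, and there the inner point
  gains. The gain is recorded as a product, which can be averaged by Fubini.\<close>

lemma nn_integral_cball_push:
  fixes g :: "'a::euclidean_space \<Rightarrow> real"
  assumes "profile g"
  shows "(\<integral>\<^sup>+x. ennreal (g x) * indicator (cball 0 r) x \<partial>lborel)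
      + (\<integral>\<^sup>+x. ennreal (1 - g x) * indicator (cball 0 r) x
            * (ennreal (g (hrefl v s x)) * indicator (- cball 0 r) (hrefl v s x)) \<partial>lborel)
    \<le> (\<integral>\<^sup>+x. ennreal (push v s g x) * indicator (cball 0 r) x \<partial>lborel)"
proof -
  note p = profile_push[OF assms, of v s]
  note [measurable] = profileD(1)[OF assms] profileD(1)[OF p]
  let ?B = "cball 0 r :: 'a set"
  have [measurable]: "?B \<in> sets borel" "- ?B \<in> sets borel" by auto
  let ?F = "\<lambda>x. ennreal (g x) * indicator ?B x + ennreal (1 - g x) * indicator ?B x
            * (ennreal (g (hrefl v s x)) * indicator (- ?B) (hrefl v s x))"
  let ?G = "\<lambda>x. ennreal (push v s g x) * indicator ?B x"
  \<comment> \<open>The true gain is the minimum of the room \<open>1 - g x\<close> and the supply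
    \<open>g (hrefl v s x)\<close>; for numbers in [0,1] it dominates their product.\<close>
  have in_out: "g x + (1 - g x) * g (hrefl v s x) \<le> push v s g x"
    if "norm x \<le> r" "\<not> norm (hrefl v s x) \<le> r" for x
  proof -
    have "(1 - g x) * g (hrefl v s x) \<le> 1 * g (hrefl v s x)"
      "(1 - g x) * g (hrefl v s x) \<le> (1 - g x) * 1"
      using profileD(2,3)[OF assms] by (intro mult_mono; simp)+
    then show ?thesis using that by (auto simp: push_def Let_def)
  qed
  have in_out': "ennreal (g x) + ennreal (1 - g x) * ennreal (g (hrefl v s x)) \<le> ennreal (push v s g x)"
    if "norm x \<le> r" "\<not> norm (hrefl v s x) \<le> r" for x
    using in_out[OF that] profileD(2,3)[OF assms] profileD(2)[OF p]
    by (simp add: ennreal_leI flip: ennreal_plus ennreal_mult)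
  have eq: "ennreal (push v s g x) + ennreal (push v s g (hrefl v s x))
      = ennreal (g x) + ennreal (g (hrefl v s x))" for x
    using push_sum[of v s g x] profileD(2)[OF assms] profileD(2)[OF p]
    by (simp flip: ennreal_plus)
  have "(\<integral>\<^sup>+x. ?F x \<partial>lborel) \<le> (\<integral>\<^sup>+x. ?G x \<partial>lborel)"
  proof (rule nn_integral_mono_hrefl[where v = v and s = s])
    fix x
    show "?F x + ?F (hrefl v s x) \<le> ?G x + ?G (hrefl v s x)"
      using in_out'[of x] in_out'[of "hrefl v s x"] eq[of x]
      by (cases "norm x \<le> r"; cases "norm (hrefl v s x) \<le> r") auto
  qed measurable
  then show ?thesis by (simp add: nn_integral_add)
qed

text \<open>Two function arguments, so that one of them can be replaced while the other stays fixed;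
  the \<open>ennreal\<close> kernel admits a singularity at distance 0.\<close>

definition interaction :: "(real \<Rightarrow> ennreal) \<Rightarrow> ('a::euclidean_space \<Rightarrow> real) \<Rightarrow> ('a \<Rightarrow> real) \<Rightarrow> ennreal" where
  "interaction \<Psi> g h = (\<integral>\<^sup>+x. \<integral>\<^sup>+y. \<Psi> (norm (x - y)) * (ennreal (g x) * ennreal (h y)) \<partial>lborel \<partial>lborel)"

text \<open>With \<open>p = q + e\<close>, each side is \<open>q\<close> times the product of the
  two sums, which agree, plus \<open>e\<close> times the diagonal term. Choosing \<open>e\<close>
  instead of subtracting covers infinite \<open>p\<close> and \<open>q\<close>.\<close>

lemma four_point_aux:
  fixes p q :: ennreal and a b a' b' A B A' B' :: real
  assumes "q \<le> p" "a * a' + b * b' \<le> A * A' + B * B'" "A + B = a + b" "A' + B' = a' + b'"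
    and nn: "0 \<le> a" "0 \<le> b" "0 \<le> a'" "0 \<le> b'" "0 \<le> A" "0 \<le> B" "0 \<le> A'" "0 \<le> B'"
  shows "p * ennreal (a * a' + b * b') + q * ennreal (a * b' + b * a')
    \<le> p * ennreal (A * A' + B * B') + q * ennreal (A * B' + B * A')"
proof -
  obtain e where e: "p = q + e" using \<open>q \<le> p\<close> by (auto simp: le_iff_add)
  have split: "p * ennreal (a * a' + b * b') + q * ennreal (a * b' + b * a')
     = q * ennreal ((a + b) * (a' + b')) + e * ennreal (a * a' + b * b')"
    if "0 \<le> a" "0 \<le> b" "0 \<le> a'" "0 \<le> b'" for a b a' b' :: real
  proof -
    have "(a + b) * (a' + b') = (a * a' + b * b') + (a * b' + b * a')"
      by (simp add: algebra_simps)
    then have "ennreal ((a + b) * (a' + b')) = ennreal (a * a' + b * b') + ennreal (a * b' + b * a')"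
      using that by (simp flip: ennreal_plus)
    then show ?thesis by (simp add: e algebra_simps)
  qed
  show ?thesis
    unfolding split[OF nn(1-4)] split[OF nn(5-8)] assms(3,4)
    by (intro add_left_mono mult_left_mono ennreal_leI assms(2)) simp
qed

text \<open>The sign of \<open>s * (x \<bullet> v - s)\<close> tells whether \<open>x\<close> lies
  on the side of the origin. On the mirror itself \<open>x\<close> is a fixed point and both
  differences vanish, so the two cases may overlap.\<close>

lemma push_diff_side:
  fixes g :: "'a::euclidean_space \<Rightarrow> real" and v :: 'a and s :: real
  assumes g: "profile g" and "s \<noteq> 0" and v: "v \<noteq> 0"
  defines "D \<equiv> \<lambda>x. push v s g x - push v s g (hrefl v s x)"
  shows "s * (x \<bullet> v - s) \<le> 0 \<Longrightarrow> \<bar>g x - g (hrefl v s x)\<bar> \<le> D x"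
    and "s * (x \<bullet> v - s) \<ge> 0 \<Longrightarrow> \<bar>g x - g (hrefl v s x)\<bar> \<le> - D x"
proof -
  have vv: "v \<bullet> v > 0" using v by simp
  have n: "(norm (hrefl v s x))\<^sup>2 = (norm x)\<^sup>2 - 4 * (s * (x \<bullet> v - s)) / (v \<bullet> v)"
    using norm_diff_hrefl[of 0 v s x] by simp
  have z: "hrefl v s x = x" if "s * (x \<bullet> v - s) = 0"
    using that \<open>s \<noteq> 0\<close> by (simp add: hrefl_def)
  note r = profileD(2,3)[OF g, of x] profileD(2,3)[OF g, of "hrefl v s x"]
  have lt: "norm x < norm (hrefl v s x)" if "s * (x \<bullet> v - s) < 0"
  proof (rule power_less_imp_less_base)
    have "4 * (s * (x \<bullet> v - s)) / (v \<bullet> v) < 0"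
      using that vv by (intro divide_neg_pos) auto
    then show "(norm x)\<^sup>2 < (norm (hrefl v s x))\<^sup>2" unfolding n by linarith
  qed simp
  have gt: "norm (hrefl v s x) < norm x" if "s * (x \<bullet> v - s) > 0"
  proof (rule power_less_imp_less_base)
    have "4 * (s * (x \<bullet> v - s)) / (v \<bullet> v) > 0"
      using that vv by (intro divide_pos_pos) auto
    then show "(norm (hrefl v s x))\<^sup>2 < (norm x)\<^sup>2" unfolding n by linarith
  qed simp
  show "\<bar>g x - g (hrefl v s x)\<bar> \<le> D x" if "s * (x \<bullet> v - s) \<le> 0"
    using that z lt r by (cases "s * (x \<bullet> v - s) = 0") (auto simp: D_def push_def)
  show "\<bar>g x - g (hrefl v s x)\<bar> \<le> - D x" if "s * (x \<bullet> v - s) \<ge> 0"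
    using that z gt r by (cases "s * (x \<bullet> v - s) = 0") (auto simp: D_def push_def)
qed

lemma push_0 [simp]: "push v 0 g = g" "push 0 s g = g"
  by (auto simp: push_def hrefl_def[of 0])

text \<open>
  For a pair of mirror points, \<open>push\<close> keeps the sum of the two values and enlarges their difference,
  in favour of the inner point. The interaction of two such pairs is, up to terms depending on the
  sums only, \<open>(\<Psi> (norm (x - y)) - \<Psi> (norm (x - r y))) / 2\<close> times the product of the differences.
\<close>

lemma push_four_point:
  fixes \<Psi> :: "real \<Rightarrow> ennreal" and g :: "'a::euclidean_space \<Rightarrow> real" and v :: 'a and s :: real
  assumes g: "profile g" and anti: "\<And>r t. 0 \<le> r \<Longrightarrow> r \<le> t \<Longrightarrow> \<Psi> t \<le> \<Psi> r"
  defines "h \<equiv> push v s g" and "r \<equiv> hrefl v s"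
  shows "\<Psi> (norm (x - y)) * ennreal (g x * g y + g (r x) * g (r y))
      + \<Psi> (norm (x - r y)) * ennreal (g x * g (r y) + g (r x) * g y)
    \<le> \<Psi> (norm (x - y)) * ennreal (h x * h y + h (r x) * h (r y))
      + \<Psi> (norm (x - r y)) * ennreal (h x * h (r y) + h (r x) * h y)"
proof (cases "s = 0 \<or> v = 0")
  case False
  then have s: "s \<noteq> 0" and v: "v \<noteq> 0" by auto
  have vv: "v \<bullet> v > 0" using v by simp
  have h: "profile h" unfolding h_def by (rule profile_push[OF g])
  note nn = profileD(2)[OF g] profileD(2)[OF h]
  have sum: "h z + h (r z) = g z + g (r z)" for z
    unfolding h_def r_def by (rule push_sum)
  note side = push_diff_side[OF g s v, folded h_def r_def]
  have par: "2 * (a * a' + b * b') = (a + b) * (a' + b') + (a - b) * (a' - b')"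
    "2 * (a * b' + b * a') = (a + b) * (a' + b') - (a - b) * (a' - b')" for a a' b b' :: real
    by (simp_all add: algebra_simps)
  have mono: "c * d \<le> C * E" if "\<bar>c\<bar> \<le> C" "\<bar>d\<bar> \<le> E" for c d C E :: real
  proof -
    have "c * d \<le> \<bar>c\<bar> * \<bar>d\<bar>" by (simp add: abs_mult[symmetric])
    also have "\<dots> \<le> C * E" using that by (intro mult_mono) auto
    finally show ?thesis .
  qed
  have n: "(norm (x - r y))\<^sup>2 = (norm (x - y))\<^sup>2 + 4 * ((x \<bullet> v - s) * (y \<bullet> v - s)) / (v \<bullet> v)"
    unfolding r_def by (simp add: norm_diff_hrefl mult.assoc)
  let ?d = "\<lambda>z. g z - g (r z)" and ?e = "\<lambda>z. h z - h (r z)"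
  \<comment> \<open>Negative on the side of the origin, where \<open>z = 0\<close> gives
    \<open>- (s * s)\<close>, and positive beyond the mirror.\<close>
  let ?m = "\<lambda>z. s * (z \<bullet> v - s)"
  have ss: "s * s > 0" using s by (auto simp: zero_less_mult_iff)
  have m: "?m x * ?m y = (s * s) * ((x \<bullet> v - s) * (y \<bullet> v - s))" by (simp add: algebra_simps)
  show ?thesis
  proof (cases "0 \<le> ?m x * ?m y")
    case True
    then have "0 \<le> (x \<bullet> v - s) * (y \<bullet> v - s)"
      unfolding m using ss by (simp add: zero_le_mult_iff)
    then have "0 \<le> 4 * ((x \<bullet> v - s) * (y \<bullet> v - s)) / (v \<bullet> v)"
      using vv by simp
    then have "(norm (x - y))\<^sup>2 \<le> (norm (x - r y))\<^sup>2" unfolding n by linarith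
    then have le: "\<Psi> (norm (x - r y)) \<le> \<Psi> (norm (x - y))"
      by (intro anti) (auto intro: power2_le_imp_le)
    have "?m x \<le> 0 \<and> ?m y \<le> 0 \<or> ?m x \<ge> 0 \<and> ?m y \<ge> 0"
      using True unfolding zero_le_mult_iff[of "?m x" "?m y"] by linarith
    then have "?d x * ?d y \<le> ?e x * ?e y"
    proof
      assume "?m x \<le> 0 \<and> ?m y \<le> 0"
      then show ?thesis by (intro mono side) auto
    next
      assume "?m x \<ge> 0 \<and> ?m y \<ge> 0"
      then have "?d x * ?d y \<le> (- ?e x) * (- ?e y)" by (intro mono side) auto
      then show ?thesis by (simp only: minus_mult_minus)
    qed
    then have "2 * (g x * g y + g (r x) * g (r y)) \<le> 2 * (h x * h y + h (r x) * h (r y))"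
      unfolding par sum by simp
    then show ?thesis
      by (intro four_point_aux le nn sum) simp
  next
    case False
    \<comment> \<open>Across the mirror, \<open>r y\<close> is the nearer partner of
      \<open>x\<close>. The previous case is repeated with \<open>y\<close> and \<open>r y\<close>
      exchanged, so the cross products carry the larger weight.\<close>
    then have "(x \<bullet> v - s) * (y \<bullet> v - s) \<le> 0"
      unfolding m by (rule contrapos_np) (rule mult_nonneg_nonneg; use ss in linarith)
    then have "4 * ((x \<bullet> v - s) * (y \<bullet> v - s)) / (v \<bullet> v) \<le> 0"
      using vv by (simp add: divide_nonpos_pos)
    then have "(norm (x - r y))\<^sup>2 \<le> (norm (x - y))\<^sup>2" unfolding n by linarith
    then have le: "\<Psi> (norm (x - y)) \<le> \<Psi> (norm (x - r y))"
      by (intro anti) (auto intro: power2_le_imp_le)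
    have "?m x \<le> 0 \<and> ?m y \<ge> 0 \<or> ?m x \<ge> 0 \<and> ?m y \<le> 0"
      using False unfolding not_le mult_less_0_iff[of "?m x" "?m y"] by linarith
    then have "?d x * (- ?d y) \<le> ?e x * (- ?e y)"
    proof
      assume *: "?m x \<le> 0 \<and> ?m y \<ge> 0"
      then show ?thesis
        using mono[OF side(1)[of x], of "- ?d y" "- ?e y"] side(2)[of y] by auto
    next
      assume *: "?m x \<ge> 0 \<and> ?m y \<le> 0"
      then have "?d x * (- ?d y) \<le> (- ?e x) * ?e y"
        using mono[OF side(2)[of x], of "- ?d y" "?e y"] side(1)[of y] by auto
      then show ?thesis by (simp only: mult_minus_left mult_minus_right)
    qed
    then have "2 * (g x * g (r y) + g (r x) * g y) \<le> 2 * (h x * h (r y) + h (r x) * h y)"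
      unfolding par(2) sum mult_minus_right by linarith
    then have "\<Psi> (norm (x - r y)) * ennreal (g x * g (r y) + g (r x) * g y)
      + \<Psi> (norm (x - y)) * ennreal (g x * g y + g (r x) * g (r y))
    \<le> \<Psi> (norm (x - r y)) * ennreal (h x * h (r y) + h (r x) * h y)
      + \<Psi> (norm (x - y)) * ennreal (h x * h y + h (r x) * h (r y))"
      by (intro four_point_aux le nn sum) (simp_all add: sum add.commute[of "g (r y)"] add.commute[of "h (r y)"])
    then show ?thesis by (simp add: add.commute)
  qed
qed (auto simp: h_def)

lemma interaction_push:
  fixes g :: "'a::euclidean_space \<Rightarrow> real"
  assumes g: "profile g" and [measurable]: "\<Psi> \<in> borel_measurable borel"
    and anti: "\<And>r t. 0 \<le> r \<Longrightarrow> r \<le> t \<Longrightarrow> \<Psi> t \<le> \<Psi> r"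
  shows "interaction \<Psi> g g \<le> interaction \<Psi> (push v s g) (push v s g)"
  unfolding interaction_def
proof (rule nn_integral_mono_hrefl2[where v = v and s = s])
  note p = profile_push[OF g, of v s]
  note [measurable] = profileD(1)[OF g] profileD(1)[OF p]
  show "(\<lambda>(x, y). \<Psi> (norm (x - y)) * (ennreal (g x) * ennreal (g y))) \<in> borel_measurable (borel \<Otimes>\<^sub>M borel)"
    "(\<lambda>(x, y). \<Psi> (norm (x - y)) * (ennreal (push v s g x) * ennreal (push v s g y)))
        \<in> borel_measurable (borel \<Otimes>\<^sub>M borel)"
    by measurable
  fix x y :: 'a
  let ?r = "hrefl v s"
  have eq: "\<Psi> (norm (x - y)) * (ennreal (h x) * ennreal (h y))
      + \<Psi> (norm (?r x - y)) * (ennreal (h (?r x)) * ennreal (h y))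
      + (\<Psi> (norm (x - ?r y)) * (ennreal (h x) * ennreal (h (?r y)))
      + \<Psi> (norm (?r x - ?r y)) * (ennreal (h (?r x)) * ennreal (h (?r y))))
    = \<Psi> (norm (x - y)) * ennreal (h x * h y + h (?r x) * h (?r y))
      + \<Psi> (norm (x - ?r y)) * ennreal (h x * h (?r y) + h (?r x) * h y)" if "profile h" for h
  proof -
    have "norm (?r x - ?r y) = norm (x - y)" "norm (?r x - y) = norm (x - ?r y)"
      using dist_hrefl[of v s x y] dist_hrefl[of v s x "?r y"] by (simp_all add: dist_norm)
    then show ?thesis
      using profileD(2)[OF that] by (simp add: ennreal_mult algebra_simps)
  qed
  show "\<Psi> (norm (x - y)) * (ennreal (g x) * ennreal (g y))
      + \<Psi> (norm (?r x - y)) * (ennreal (g (?r x)) * ennreal (g y))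
      + (\<Psi> (norm (x - ?r y)) * (ennreal (g x) * ennreal (g (?r y)))
      + \<Psi> (norm (?r x - ?r y)) * (ennreal (g (?r x)) * ennreal (g (?r y))))
    \<le> \<Psi> (norm (x - y)) * (ennreal (push v s g x) * ennreal (push v s g y))
      + \<Psi> (norm (?r x - y)) * (ennreal (push v s g (?r x)) * ennreal (push v s g y))
      + (\<Psi> (norm (x - ?r y)) * (ennreal (push v s g x) * ennreal (push v s g (?r y)))
      + \<Psi> (norm (?r x - ?r y)) * (ennreal (push v s g (?r x)) * ennreal (push v s g (?r y))))"
    unfolding eq[OF g] eq[OF p] by (rule push_four_point[OF g anti])
qed


subsection \<open>Averaging over reflections\<close>

text \<open>Used to cut out a ball around \<open>x\<close>, near which the weight
  \<open>(norm (y - x))\<^sup>2\<close> produced by the averaging degenerates. The radius must not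
  depend on \<open>x\<close>.\<close>

lemma emeasure_ball_small:
  fixes \<delta> :: real
  assumes "0 < \<delta>"
  obtains \<epsilon> where "0 < \<epsilon>" "\<And>x::'a::euclidean_space. emeasure lborel (ball x \<epsilon>) \<le> ennreal \<delta>"
proof -
  let ?u = "unit_ball_vol (real DIM('a))"
  define \<epsilon> where "\<epsilon> = min 1 (\<delta> / ?u)"
  have u: "?u > 0" by simp
  have e: "0 < \<epsilon>" "\<epsilon> \<le> 1" "\<epsilon> * ?u \<le> \<delta>"
    using assms u by (auto simp: \<epsilon>_def min_def field_simps)
  have "?u * \<epsilon> ^ DIM('a) \<le> ?u * \<epsilon> ^ 1"
    using e u DIM_positive[where 'a = 'a] by (intro mult_left_mono power_decreasing) auto
  also have "\<dots> \<le> \<delta>" using e by (simp add: mult.commute)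
  finally have "emeasure lborel (ball x \<epsilon>) \<le> ennreal \<delta>" for x :: 'a
    using e by (simp add: emeasure_ball ennreal_leI)
  then show ?thesis using e that by blast
qed

text \<open>
  For fixed \<open>x\<close>, averaging \<open>h (\<sigma> x)\<close> over the reflections \<open>\<sigma>\<close> in the hyperplanes
  \<open>z \<bullet> v = s\<close> only involves affine changes of variables: with \<open>s = x \<bullet> v + t (v \<bullet> v) / 2\<close>
  one has \<open>\<sigma> x = x + t v\<close>, which is integrated in \<open>v\<close> for fixed \<open>t \<in> [1, 2]\<close>.
\<close>

lemma hrefl_average_ge:
  fixes h :: "'a::euclidean_space \<Rightarrow> ennreal"
  assumes [measurable]: "h \<in> borel_measurable borel"
    and supp: "\<And>y. norm y > M \<Longrightarrow> h y = 0" and x: "norm x \<le> R"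
    and "0 \<le> M" "0 \<le> R" and N: "N = M + R" and S: "S = R * N + N * N"
  shows "(\<integral>\<^sup>+y. h y * ennreal ((norm (y - x))\<^sup>2) \<partial>lborel) \<le>
    ennreal (2 ^ DIM('a) * 8) * (\<integral>\<^sup>+v. indicator (cball 0 N) v *
       (\<integral>\<^sup>+s. indicator {-S..S} s * h (hrefl v s x) \<partial>lborel) \<partial>lborel)"
proof -
  have "0 \<le> N" using assms by simp
  have [measurable]: "cball (0::'a) N \<in> sets borel" by auto
  \<comment> \<open>The factor is the Jacobian of the substitution of \<open>t\<close> for
    \<open>s\<close>. Restricting to \<open>t\<close> in [1,2] keeps the scale of \<open>v\<close>
    comparable to the displacement of \<open>x\<close>.\<close>
  have s_sub: "ennreal (v \<bullet> v / 2) * (\<integral>\<^sup>+t. indicator {1..2} t * h (x + t *\<^sub>R v) \<partial>lborel)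
      \<le> (\<integral>\<^sup>+s. indicator {-S..S} s * h (hrefl v s x) \<partial>lborel)" if "norm v \<le> N" for v
  proof (cases "v = 0")
    case False
    then have c: "v \<bullet> v / 2 > 0" by simp
    have vv: "v \<bullet> v \<le> N * N"
      using mult_mono[OF that that] \<open>0 \<le> N\<close> by (simp add: dot_square_norm power2_eq_square)
    have xv: "\<bar>x \<bullet> v\<bar> \<le> R * N"
      using Cauchy_Schwarz_ineq2[of x v] mult_mono[OF x that] \<open>0 \<le> R\<close> by simp
    have "(\<integral>\<^sup>+s. indicator {-S..S} s * h (hrefl v s x) \<partial>lborel)
      = ennreal \<bar>v \<bullet> v / 2\<bar> * (\<integral>\<^sup>+t. indicator {-S..S} (x \<bullet> v + v \<bullet> v / 2 * t)
           * h (hrefl v (x \<bullet> v + v \<bullet> v / 2 * t) x) \<partial>lborel)"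
      using c by (subst nn_integral_real_affine[where c = "v \<bullet> v / 2" and t = "x \<bullet> v"]) auto
    also have "\<dots> \<ge> ennreal \<bar>v \<bullet> v / 2\<bar> * (\<integral>\<^sup>+t. indicator {1..2} t * h (x + t *\<^sub>R v) \<partial>lborel)"
    proof (intro mult_left_mono nn_integral_mono)
      fix t :: real
      have "hrefl v (x \<bullet> v + v \<bullet> v / 2 * t) x = x + t *\<^sub>R v"
        using False by (simp add: hrefl_def)
      \<comment> \<open>Origin of \<open>S\<close>: the summand \<open>R * N\<close> covers
        \<open>x \<bullet> v\<close>, and \<open>N * N\<close> covers
        \<open>v \<bullet> v / 2 * t\<close> up to \<open>t = 2\<close>.\<close>
      moreover have "x \<bullet> v + v \<bullet> v / 2 * t \<in> {-S..S}" if "t \<in> {1..2}"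
      proof -
        have "v \<bullet> v / 2 * t \<le> v \<bullet> v / 2 * 2" "0 \<le> v \<bullet> v / 2 * t"
          using c that by (intro mult_left_mono mult_nonneg_nonneg; simp)+
        then show ?thesis using vv xv S by auto
      qed
      ultimately show "indicator {1..2} t * h (x + t *\<^sub>R v)
         \<le> indicator {-S..S} (x \<bullet> v + v \<bullet> v / 2 * t) * h (hrefl v (x \<bullet> v + v \<bullet> v / 2 * t) x)"
        by (auto simp: indicator_def)
    qed simp
    finally show ?thesis using c by simp
  qed simp
  let ?k = "\<lambda>t v. indicator (cball 0 N) v * (ennreal (v \<bullet> v / 2) * h (x + t *\<^sub>R v))"
  \<comment> \<open>The power of 2 bounds the Jacobian of \<open>y = x + t *\<^sub>R v\<close>; the
    8 comes from \<open>t * t \<le> 4\<close> and the half in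
    \<open>v \<bullet> v / 2\<close>.\<close>
  have v_sub: "(\<integral>\<^sup>+y. h y * ennreal ((norm (y - x))\<^sup>2) \<partial>lborel)
      \<le> ennreal (2 ^ DIM('a) * 8) * (\<integral>\<^sup>+v. ?k t v \<partial>lborel)" if t: "t \<in> {1..2}" for t
  proof -
    have "(\<integral>\<^sup>+y. h y * ennreal ((norm (y - x))\<^sup>2) \<partial>lborel)
      = ennreal (\<bar>t\<bar> ^ DIM('a)) * (\<integral>\<^sup>+v. h (x + t *\<^sub>R v) * ennreal ((norm (t *\<^sub>R v))\<^sup>2) \<partial>lborel)"
      using t by (subst nn_integral_lborel_affine[where c = t and t = x]) auto
    also have "\<dots> \<le> ennreal (2 ^ DIM('a)) * (\<integral>\<^sup>+v. ennreal 8 * ?k t v \<partial>lborel)"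
    proof (rule mult_mono[OF ennreal_leI nn_integral_mono])
      fix v :: 'a
      show "h (x + t *\<^sub>R v) * ennreal ((norm (t *\<^sub>R v))\<^sup>2) \<le> ennreal 8 * ?k t v"
      proof (cases "norm v \<le> N")
        case True
        have "t * t \<le> 2 * 2" using t by (intro mult_mono) auto
        then have "(t * t) * (v \<bullet> v) \<le> 4 * (v \<bullet> v)" by (intro mult_right_mono) auto
        then have "(norm (t *\<^sub>R v))\<^sup>2 \<le> 8 * (v \<bullet> v / 2)"
          by (simp add: power_mult_distrib power2_norm_eq_inner[symmetric] power2_eq_square)
             (simp add: algebra_simps)
        then have "ennreal ((norm (t *\<^sub>R v))\<^sup>2) \<le> ennreal 8 * ennreal (v \<bullet> v / 2)"
          by (metis ennreal_leI ennreal_mult inner_ge_zero zero_le_numeral divide_nonneg_nonneg)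
        then have "h (x + t *\<^sub>R v) * ennreal ((norm (t *\<^sub>R v))\<^sup>2)
           \<le> h (x + t *\<^sub>R v) * (ennreal 8 * ennreal (v \<bullet> v / 2))" by (rule mult_left_mono) simp
        then show ?thesis using True by (simp add: mult_ac)
      next
        case False
        \<comment> \<open>As \<open>t \<ge> 1\<close>, a vector longer than \<open>N = M + R\<close>
          carries \<open>x\<close> out of the support of \<open>h\<close>, so the restriction to
          \<open>cball 0 N\<close> loses nothing.\<close>
        have "norm (t *\<^sub>R v) \<ge> norm v"
          using t mult_right_mono[of 1 t "norm v"] by simp
        then have "norm (x + t *\<^sub>R v) > M"
          using False x N norm_triangle_ineq2[of "t *\<^sub>R v" "- x"] by (simp add: add.commute)
        then show ?thesis by (simp add: supp)
      qed
    qed (use t in \<open>auto intro: power_mono\<close>)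
    also have "\<dots> = ennreal (2 ^ DIM('a) * 8) * (\<integral>\<^sup>+v. ?k t v \<partial>lborel)"
      by (simp add: nn_integral_cmult ennreal_mult mult.assoc)
    finally show ?thesis .
  qed
  \<comment> \<open>The interval [1,2] has length 1, so the bound valid for each \<open>t\<close>
    can be integrated over \<open>t\<close> without a further constant.\<close>
  have "(\<integral>\<^sup>+y. h y * ennreal ((norm (y - x))\<^sup>2) \<partial>lborel)
     = (\<integral>\<^sup>+t. indicator {1..2::real} t * (\<integral>\<^sup>+y. h y * ennreal ((norm (y - x))\<^sup>2) \<partial>lborel) \<partial>lborel)"
    by (simp add: nn_integral_multc)
  also have "\<dots> \<le> (\<integral>\<^sup>+t. ennreal (2 ^ DIM('a) * 8) * (indicator {1..2::real} t * (\<integral>\<^sup>+v. ?k t v \<partial>lborel)) \<partial>lborel)"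
    using v_sub by (intro nn_integral_mono) (auto simp: indicator_def)
  also have "\<dots> = ennreal (2 ^ DIM('a) * 8) * (\<integral>\<^sup>+t. \<integral>\<^sup>+v. indicator {1..2::real} t * ?k t v \<partial>lborel \<partial>lborel)"
    by (simp add: nn_integral_cmult)
  also have "(\<integral>\<^sup>+t. \<integral>\<^sup>+v. indicator {1..2::real} t * ?k t v \<partial>lborel \<partial>lborel)
    = (\<integral>\<^sup>+v. \<integral>\<^sup>+t. indicator {1..2::real} t * ?k t v \<partial>lborel \<partial>lborel)"
    by (rule lborel_pair.Fubini') simp
  also have "\<dots> = (\<integral>\<^sup>+v. indicator (cball 0 N) v * (ennreal (v \<bullet> v / 2) *
      (\<integral>\<^sup>+t. indicator {1..2} t * h (x + t *\<^sub>R v) \<partial>lborel)) \<partial>lborel)"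
    by (simp add: nn_integral_cmult[symmetric] mult_ac)
  also have "ennreal (2 ^ DIM('a) * 8) * \<dots> \<le> ennreal (2 ^ DIM('a) * 8) * (\<integral>\<^sup>+v. indicator (cball 0 N) v *
       (\<integral>\<^sup>+s. indicator {-S..S} s * h (hrefl v s x) \<partial>lborel) \<partial>lborel)"
    by (rule mult_left_mono[OF nn_integral_mono]) (auto simp: indicator_def[of "cball 0 N"] s_sub)
  finally show ?thesis .
qed

text \<open>The average of \<open>h (hrefl v s x)\<close> over a bounded parameter set is bounded
  below uniformly in \<open>x\<close>; integrated against \<open>f\<close>, it shows that not all
  reflections can have small overlap. The bound \<open>\<eta>\<close> depends on \<open>R\<close>,
  \<open>M\<close>, \<open>\<delta>\<close> and the dimension only.\<close>

lemma hrefl_overlap: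
  fixes R M \<delta> :: real
  assumes "0 \<le> R" "0 \<le> M" "0 < \<delta>"
  shows "\<exists>\<eta>>0. \<forall>f h :: 'a::euclidean_space \<Rightarrow> ennreal.
      f \<in> borel_measurable borel \<longrightarrow> h \<in> borel_measurable borel \<longrightarrow>
      (\<forall>x. norm x > R \<longrightarrow> f x = 0) \<longrightarrow> (\<forall>y. norm y > M \<longrightarrow> h y = 0) \<longrightarrow> (\<forall>y. h y \<le> 1) \<longrightarrow>
      ennreal \<delta> \<le> (\<integral>\<^sup>+x. f x \<partial>lborel) \<longrightarrow> ennreal \<delta> \<le> (\<integral>\<^sup>+x. h x \<partial>lborel) \<longrightarrow>
      (\<exists>v s. ennreal \<eta> \<le> (\<integral>\<^sup>+x. f x * h (hrefl v s x) \<partial>lborel))"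
proof -
  obtain \<epsilon> where e: "0 < \<epsilon>" and small: "\<And>x::'a. emeasure lborel (ball x \<epsilon>) \<le> ennreal (\<delta> / 2)"
    using emeasure_ball_small[of "\<delta> / 2"] assms by (auto simp del: ennreal_half)
  define N where "N = M + R"
  define S where "S = R * N + N * N"
  have N: "0 \<le> N" and S: "0 \<le> S" using assms by (auto simp: N_def S_def)
  define C where "C = (2::real) ^ DIM('a) * 8"
  have C: "0 < C" by (simp add: C_def)
  define K where "K = 2 * S * (unit_ball_vol (real DIM('a)) * N ^ DIM('a))"
  have K: "0 \<le> K" using N S by (simp add: K_def)
  \<comment> \<open>\<open>K\<close> is the measure of the parameter set. If all overlaps were at
    most \<open>\<eta>\<close>, averaging would give the reverse of the strict inequality
    \<open>lt\<close>; \<open>K + 1\<close> keeps the denominator positive when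
    \<open>K = 0\<close>.\<close>
  define \<eta> where "\<eta> = \<delta> * (\<epsilon>\<^sup>2 * (\<delta> / 2)) / (2 * C * (K + 1))"
  have \<eta>: "0 < \<eta>" using e assms C K by (simp add: \<eta>_def)
  have lt: "C * (\<eta> * K) < \<delta> * (\<epsilon>\<^sup>2 * (\<delta> / 2))"
  proof -
    have "C * (\<eta> * K) \<le> C * (\<eta> * (K + 1))" using C \<eta> by simp
    also have "\<dots> < \<eta> * (2 * C * (K + 1))"
      using C \<eta> K by (simp add: mult_pos_pos add_nonneg_pos)
    also have "\<dots> = \<delta> * (\<epsilon>\<^sup>2 * (\<delta> / 2))"
      using C K unfolding \<eta>_def by (intro nonzero_eq_divide_eq[THEN iffD1, OF _ refl]) simp
    finally show ?thesis .
  qed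
  show ?thesis
  proof (rule exI[of _ \<eta>], intro conjI \<eta> allI impI)
    fix f h :: "'a \<Rightarrow> ennreal"
    assume [measurable]: "f \<in> borel_measurable borel" "h \<in> borel_measurable borel"
      and f0_all: "\<forall>x. norm x > R \<longrightarrow> f x = 0" and h0_all: "\<forall>y. norm y > M \<longrightarrow> h y = 0"
      and h1_all: "\<forall>y. h y \<le> 1" and fd: "ennreal \<delta> \<le> (\<integral>\<^sup>+x. f x \<partial>lborel)"
      and hd: "ennreal \<delta> \<le> (\<integral>\<^sup>+x. h x \<partial>lborel)"
    note f0 = f0_all[rule_format] and h0 = h0_all[rule_format] and h1 = h1_all[rule_format]
    have [measurable]: "cball (0::'a) N \<in> sets borel" by auto
    define A where "A = (\<lambda>x. \<integral>\<^sup>+v. indicator (cball 0 N) v *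
       (\<integral>\<^sup>+s. indicator {-S..S} s * h (hrefl v s x) \<partial>lborel) \<partial>lborel)"
    have [measurable]: "A \<in> borel_measurable borel" unfolding A_def by measurable
    have [measurable]: "ball x \<epsilon> \<in> sets borel" "- ball x \<epsilon> \<in> sets borel" for x :: 'a
      by auto
    \<comment> \<open>Since \<open>h \<le> 1\<close>, the small ball holds at most
      \<open>\<delta> / 2\<close> of the mass of \<open>h\<close>; the rest sits where the weight is
      at least \<open>\<epsilon>\<^sup>2\<close>.\<close>
    have A: "ennreal (\<epsilon>\<^sup>2 * (\<delta> / 2)) \<le> ennreal C * A x" if "norm x \<le> R" for x
    proof -
      have "ennreal (\<delta> / 2) + ennreal (\<delta> / 2) = ennreal \<delta>"
        using assms by (simp flip: ennreal_plus)
      also have "\<dots> \<le> (\<integral>\<^sup>+y. h y \<partial>lborel)" by (rule hd)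
      also have "\<dots> \<le> (\<integral>\<^sup>+y. indicator (ball x \<epsilon>) y + h y * indicator (- ball x \<epsilon>) y \<partial>lborel)"
        using h1 by (intro nn_integral_mono) (auto simp: indicator_def)
      also have "\<dots> = emeasure lborel (ball x \<epsilon>) + (\<integral>\<^sup>+y. h y * indicator (- ball x \<epsilon>) y \<partial>lborel)"
        by (subst nn_integral_add) auto
      also have "\<dots> \<le> ennreal (\<delta> / 2) + (\<integral>\<^sup>+y. h y * indicator (- ball x \<epsilon>) y \<partial>lborel)"
        by (intro add_right_mono small)
      finally have "ennreal (\<delta> / 2) \<le> (\<integral>\<^sup>+y. h y * indicator (- ball x \<epsilon>) y \<partial>lborel)"
        by (subst (asm) ennreal_add_left_cancel_le) simp
      then have "ennreal (\<epsilon>\<^sup>2 * (\<delta> / 2)) \<le> ennreal (\<epsilon>\<^sup>2) * (\<integral>\<^sup>+y. h y * indicator (- ball x \<epsilon>) y \<partial>lborel)"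
        by (subst ennreal_mult) (use assms in \<open>auto intro: mult_left_mono\<close>)
      also have "\<dots> = (\<integral>\<^sup>+y. ennreal (\<epsilon>\<^sup>2) * (h y * indicator (- ball x \<epsilon>) y) \<partial>lborel)"
        by (subst nn_integral_cmult) auto
      also have "\<dots> \<le> (\<integral>\<^sup>+y. h y * ennreal ((norm (y - x))\<^sup>2) \<partial>lborel)"
      proof (rule nn_integral_mono)
        fix y
        have "ennreal (\<epsilon>\<^sup>2) \<le> ennreal ((norm (y - x))\<^sup>2)" if "y \<notin> ball x \<epsilon>"
          using that e by (intro ennreal_leI power_mono) (auto simp: dist_norm norm_minus_commute)
        then show "ennreal (\<epsilon>\<^sup>2) * (h y * indicator (- ball x \<epsilon>) y) \<le> h y * ennreal ((norm (y - x))\<^sup>2)"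
          by (cases "y \<in> ball x \<epsilon>") (auto simp: mult.commute[of "h y"] intro: mult_right_mono)
      qed
      also have "\<dots> \<le> ennreal C * A x"
        unfolding A_def C_def
        by (rule hrefl_average_ge[of h M x R N S, OF _ h0 that]) (use assms in \<open>auto simp: N_def S_def\<close>)
      finally show ?thesis .
    qed
    show "\<exists>v s. ennreal \<eta> \<le> (\<integral>\<^sup>+x. f x * h (hrefl v s x) \<partial>lborel)"
    proof (rule ccontr)
      assume "\<not> ?thesis"
      then have le: "(\<integral>\<^sup>+x. f x * h (hrefl v s x) \<partial>lborel) \<le> ennreal \<eta>" for v s
        by (meson linear)
      have "ennreal (\<delta> * (\<epsilon>\<^sup>2 * (\<delta> / 2))) = ennreal \<delta> * ennreal (\<epsilon>\<^sup>2 * (\<delta> / 2))"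
        using assms by (intro ennreal_mult) auto
      also have "\<dots> \<le> (\<integral>\<^sup>+x. f x \<partial>lborel) * ennreal (\<epsilon>\<^sup>2 * (\<delta> / 2))"
        by (rule mult_right_mono[OF fd]) simp
      also have "\<dots> = (\<integral>\<^sup>+x. f x * ennreal (\<epsilon>\<^sup>2 * (\<delta> / 2)) \<partial>lborel)"
        by (simp add: nn_integral_multc)
      also have "\<dots> \<le> (\<integral>\<^sup>+x. ennreal C * (f x * A x) \<partial>lborel)"
      proof (rule nn_integral_mono)
        fix x
        show "f x * ennreal (\<epsilon>\<^sup>2 * (\<delta> / 2)) \<le> ennreal C * (f x * A x)"
          using mult_left_mono[OF A[of x], of "f x"] f0[of x] by (cases "norm x \<le> R") (auto simp: mult_ac)
      qed
      also have "\<dots> = ennreal C * (\<integral>\<^sup>+x. f x * A x \<partial>lborel)"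
        by (simp add: nn_integral_cmult)
      also have "(\<integral>\<^sup>+x. f x * A x \<partial>lborel) = (\<integral>\<^sup>+x. \<integral>\<^sup>+v. \<integral>\<^sup>+s.
          indicator (cball 0 N) v * (indicator {-S..S} s * (f x * h (hrefl v s x))) \<partial>lborel \<partial>lborel \<partial>lborel)"
        unfolding A_def by (simp add: nn_integral_cmult[symmetric] mult_ac)
      also have "\<dots> = (\<integral>\<^sup>+v. \<integral>\<^sup>+x. \<integral>\<^sup>+s.
          indicator (cball 0 N) v * (indicator {-S..S} s * (f x * h (hrefl v s x))) \<partial>lborel \<partial>lborel \<partial>lborel)"
        by (rule lborel_pair.Fubini') simp
      also have "\<dots> = (\<integral>\<^sup>+v. \<integral>\<^sup>+s. \<integral>\<^sup>+x.
          indicator (cball 0 N) v * (indicator {-S..S} s * (f x * h (hrefl v s x))) \<partial>lborel \<partial>lborel \<partial>lborel)"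
        by (intro nn_integral_cong lborel_pair.Fubini') simp
      also have "\<dots> = (\<integral>\<^sup>+v. indicator (cball 0 N) v * (\<integral>\<^sup>+s. indicator {-S..S} s *
           (\<integral>\<^sup>+x. f x * h (hrefl v s x) \<partial>lborel) \<partial>lborel) \<partial>lborel)"
        by (simp add: nn_integral_cmult)
      also have "\<dots> \<le> (\<integral>\<^sup>+v. indicator (cball 0 N) v * (\<integral>\<^sup>+s. indicator {-S..S} s * ennreal \<eta> \<partial>lborel) \<partial>(lborel :: 'a measure))"
        by (intro nn_integral_mono mult_left_mono le) auto
      also have "\<dots> = ennreal (\<eta> * K)"
      proof -
        have "(\<integral>\<^sup>+s. indicator {-S..S} s * ennreal \<eta> \<partial>lborel) = ennreal (2 * S * \<eta>)"
          using S \<eta> by (subst nn_integral_multc) (auto simp flip: ennreal_mult)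
        then show ?thesis
          using N S \<eta> by (simp add: nn_integral_multc emeasure_cball K_def mult_ac flip: ennreal_mult)
      qed
      finally have "ennreal (\<delta> * (\<epsilon>\<^sup>2 * (\<delta> / 2))) \<le> ennreal (C * (\<eta> * K))"
        using C \<eta> K by (simp add: ennreal_mult mult_left_mono)
      then have "\<delta> * (\<epsilon>\<^sup>2 * (\<delta> / 2)) \<le> C * (\<eta> * K)"
        using C \<eta> K by (subst (asm) ennreal_le_iff) auto
      with lt show False by simp
    qed
  qed
qed


subsection \<open>Optimality of the ball for the exchange term\<close>

text \<open>The overlap bound is applied to the free room inside the ball and to the mass in the
  surrounding shell. The quantifier order matters: \<open>\<eta>\<close> is fixed before
  \<open>g\<close>, so the gain can be collected repeatedly.\<close>

lemma push_gain:
  fixes R M \<delta> :: real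
  assumes "0 \<le> R" "0 \<le> M" "0 < \<delta>"
  shows "\<exists>\<eta>>0. \<forall>g :: 'a::euclidean_space \<Rightarrow> real. profile g \<longrightarrow>
      ennreal \<delta> \<le> (\<integral>\<^sup>+x. ennreal (1 - g x) * indicator (cball 0 R) x \<partial>lborel) \<longrightarrow>
      ennreal \<delta> \<le> (\<integral>\<^sup>+x. ennreal (g x) * indicator (cball 0 M - cball 0 R) x \<partial>lborel) \<longrightarrow>
      (\<exists>v s. (\<integral>\<^sup>+x. ennreal (g x) * indicator (cball 0 R) x \<partial>lborel) + ennreal \<eta>
        \<le> (\<integral>\<^sup>+x. ennreal (push v s g x) * indicator (cball 0 R) x \<partial>lborel))"
proof -
  obtain \<eta> where \<eta>: "0 < \<eta>" and overlap: "\<forall>f h :: 'a \<Rightarrow> ennreal.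
      f \<in> borel_measurable borel \<longrightarrow> h \<in> borel_measurable borel \<longrightarrow>
      (\<forall>x. norm x > R \<longrightarrow> f x = 0) \<longrightarrow> (\<forall>y. norm y > M \<longrightarrow> h y = 0) \<longrightarrow> (\<forall>y. h y \<le> 1) \<longrightarrow>
      ennreal \<delta> \<le> (\<integral>\<^sup>+x. f x \<partial>lborel) \<longrightarrow> ennreal \<delta> \<le> (\<integral>\<^sup>+x. h x \<partial>lborel) \<longrightarrow>
      (\<exists>v s. ennreal \<eta> \<le> (\<integral>\<^sup>+x. f x * h (hrefl v s x) \<partial>lborel))"
    using hrefl_overlap[OF assms, where 'a = 'a] by (elim exE conjE)
  show ?thesis
  proof (rule exI[of _ \<eta>], intro conjI \<eta> allI impI)
    fix g :: "'a \<Rightarrow> real"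
    assume g: "profile g"
      and f: "ennreal \<delta> \<le> (\<integral>\<^sup>+x. ennreal (1 - g x) * indicator (cball 0 R) x \<partial>lborel)"
      and h: "ennreal \<delta> \<le> (\<integral>\<^sup>+x. ennreal (g x) * indicator (cball 0 M - cball 0 R) x \<partial>lborel)"
    note [measurable] = profileD(1)[OF g]
    have [measurable]: "cball 0 R \<in> sets (borel :: 'a measure)" "- cball 0 R \<in> sets (borel :: 'a measure)"
      "cball 0 M - cball 0 R \<in> sets (borel :: 'a measure)" by auto
    have "\<exists>v s. ennreal \<eta> \<le> (\<integral>\<^sup>+x. ennreal (1 - g x) * indicator (cball 0 R) x
        * (ennreal (g (hrefl v s x)) * indicator (cball 0 M - cball 0 R) (hrefl v s x)) \<partial>lborel)"
      using profileD[OF g] by (intro overlap[rule_format] f h) (auto simp: indicator_def)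
    then obtain v s where vs: "ennreal \<eta> \<le> (\<integral>\<^sup>+x. ennreal (1 - g x) * indicator (cball 0 R) x
        * (ennreal (g (hrefl v s x)) * indicator (cball 0 M - cball 0 R) (hrefl v s x)) \<partial>lborel)"
      by blast
    also have "\<dots> \<le> (\<integral>\<^sup>+x. ennreal (1 - g x) * indicator (cball 0 R) x
        * (ennreal (g (hrefl v s x)) * indicator (- cball 0 R) (hrefl v s x)) \<partial>lborel)"
      by (intro nn_integral_mono mult_left_mono) (auto simp: indicator_def)
    finally show "\<exists>v s. (\<integral>\<^sup>+x. ennreal (g x) * indicator (cball 0 R) x \<partial>lborel) + ennreal \<eta>
        \<le> (\<integral>\<^sup>+x. ennreal (push v s g x) * indicator (cball 0 R) x \<partial>lborel)"
      by (intro exI[of _ v] exI[of _ s] order_trans[OF add_left_mono nn_integral_cball_push[OF g]])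
  qed
qed

lemma profile_tail:
  fixes g :: "'a::euclidean_space \<Rightarrow> real"
  assumes g: "profile g" and V: "(\<integral>\<^sup>+x. ennreal (g x) \<partial>lborel) = ennreal V" and "0 < \<delta>"
  obtains M where "0 \<le> M" "ennreal V \<le> (\<integral>\<^sup>+x. ennreal (g x) * indicator (cball 0 M) x \<partial>lborel) + ennreal \<delta>"
proof -
  note [measurable] = profileD(1)[OF g]
  let ?I = "\<lambda>n. \<integral>\<^sup>+x. ennreal (g x) * indicator (cball 0 (real n)) x \<partial>lborel"
  have sup: "(SUP n. ennreal (g x) * indicator (cball 0 (real n)) x) = ennreal (g x)" for x
  proof (rule antisym)
    obtain n where "norm x \<le> real n" using real_arch_simple by blast
    then show "ennreal (g x) \<le> (SUP n. ennreal (g x) * indicator (cball 0 (real n)) x)"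
      by (intro SUP_upper2[of n]) auto
  qed (auto intro!: SUP_least simp: indicator_def)
  have "ennreal V = (\<integral>\<^sup>+x. (SUP n. ennreal (g x) * indicator (cball 0 (real n)) x) \<partial>lborel)"
    unfolding sup V ..
  also have "\<dots> = (SUP n. ?I n)"
  proof (rule nn_integral_monotone_convergence_SUP)
    show "incseq (\<lambda>n x. ennreal (g x) * indicator (cball 0 (real n)) x)"
      by (rule incseq_SucI) (auto simp: le_fun_def indicator_def)
    fix n :: nat
    have [measurable]: "cball 0 (real n) \<in> sets (borel :: 'a measure)" by auto
    show "(\<lambda>x. ennreal (g x) * indicator (cball 0 (real n)) x) \<in> borel_measurable lborel"
      by measurable
  qed
  finally have SUP: "ennreal V = (SUP n. ?I n)" .
  show ?thesis
  proof (cases "V \<le> 0")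
    case True
    then show ?thesis by (intro that[of 0]) (auto simp: ennreal_neg)
  next
    case False
    then have "ennreal (V - \<delta>) < ennreal V" using \<open>0 < \<delta>\<close> by (intro ennreal_lessI) auto
    then obtain n where n: "ennreal (V - \<delta>) < ?I n"
      unfolding SUP less_SUP_iff by blast
    have "ennreal V \<le> ennreal (V - \<delta>) + ennreal \<delta>"
      using \<open>0 < \<delta>\<close> by (cases "\<delta> \<le> V") (auto simp: ennreal_neg ennreal_leI simp flip: ennreal_plus)
    also have "\<dots> \<le> ?I n + ennreal \<delta>" using n by (intro add_right_mono) simp
    finally show ?thesis by (intro that[of "real n"]) auto
  qed
qed

text \<open>Otherwise every function reachable by pushes could be improved by the same
  \<open>\<eta>\<close>, and after \<open>n\<close> steps the mass in the ball would be at least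
  \<open>n * \<eta>\<close>, although it never exceeds the volume of the ball.\<close>

lemma exists_concentrated:
  fixes g0 :: "'a::euclidean_space \<Rightarrow> real"
  assumes g0: "profile g0" and mass: "(\<integral>\<^sup>+x. ennreal (g0 x) \<partial>lborel) = emeasure lborel (cball (0::'a) R)"
    and "0 \<le> R" "0 < \<delta>" and [measurable]: "\<Psi> \<in> borel_measurable borel"
    and anti: "\<And>r t. 0 \<le> r \<Longrightarrow> r \<le> t \<Longrightarrow> \<Psi> t \<le> \<Psi> r"
  obtains g :: "'a \<Rightarrow> real" where "profile g" "interaction \<Psi> g0 g0 \<le> interaction \<Psi> g g"
    "(\<integral>\<^sup>+x. ennreal (g x) \<partial>lborel) = emeasure lborel (cball (0::'a) R)"
    "(\<integral>\<^sup>+x. ennreal (g x) * indicator (- cball 0 R) x \<partial>lborel) \<le> ennreal \<delta>"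
proof -
  let ?B = "cball 0 R :: 'a set"
  have [measurable]: "?B \<in> sets borel" "- ?B \<in> sets borel" by auto
  define V where "V = unit_ball_vol (real DIM('a)) * R ^ DIM('a)"
  have V0: "0 \<le> V" and emV: "emeasure lborel ?B = ennreal V"
    using \<open>0 \<le> R\<close> by (simp_all add: emeasure_cball V_def)
  obtain M where M: "0 \<le> M"
    and tail: "ennreal V \<le> (\<integral>\<^sup>+x. ennreal (g0 x) * indicator (cball 0 M) x \<partial>lborel) + ennreal (\<delta> / 2)"
    by (rule profile_tail[OF g0 mass[unfolded emV] half_gt_zero[OF \<open>0 < \<delta>\<close>]])
  have [measurable]: "cball 0 M \<in> sets (borel :: 'a measure)" "cball 0 M - ?B \<in> sets (borel :: 'a measure)" by auto
  obtain \<eta> where \<eta>: "0 < \<eta>" and gain: "\<forall>g :: 'a \<Rightarrow> real. profile g \<longrightarrow>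
      ennreal (\<delta> / 2) \<le> (\<integral>\<^sup>+x. ennreal (1 - g x) * indicator ?B x \<partial>lborel) \<longrightarrow>
      ennreal (\<delta> / 2) \<le> (\<integral>\<^sup>+x. ennreal (g x) * indicator (cball 0 M - ?B) x \<partial>lborel) \<longrightarrow>
      (\<exists>v s. (\<integral>\<^sup>+x. ennreal (g x) * indicator ?B x \<partial>lborel) + ennreal \<eta>
        \<le> (\<integral>\<^sup>+x. ennreal (push v s g x) * indicator ?B x \<partial>lborel))"
    using push_gain[OF \<open>0 \<le> R\<close> M half_gt_zero[OF \<open>0 < \<delta>\<close>], where 'a = 'a] by (elim exE conjE)
  \<comment> \<open>A class invariant under \<open>push\<close>. Its last condition transfers the
    tail bound for \<open>g0\<close>, and hence the choice of \<open>M\<close>, to all its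
    members.\<close>
  define X where "X = {g :: 'a \<Rightarrow> real. profile g \<and> interaction \<Psi> g0 g0 \<le> interaction \<Psi> g g \<and>
    (\<integral>\<^sup>+x. ennreal (g x) \<partial>lborel) = ennreal V \<and>
    (\<integral>\<^sup>+x. ennreal (g0 x) * indicator (cball 0 M) x \<partial>lborel)
       \<le> (\<integral>\<^sup>+x. ennreal (g x) * indicator (cball 0 M) x \<partial>lborel)}"
  have X0: "g0 \<in> X" using g0 mass emV by (simp add: X_def)
  have push_X: "push v s g \<in> X" if "g \<in> X" for v s g
  proof -
    have g: "profile g" using that by (simp add: X_def)
    have "(\<integral>\<^sup>+x. ennreal (g x) * indicator (cball 0 M) x \<partial>lborel)
       \<le> (\<integral>\<^sup>+x. ennreal (push v s g x) * indicator (cball 0 M) x \<partial>lborel)"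
      by (rule order_trans[OF _ nn_integral_cball_push[OF g]]) simp
    then show ?thesis
      using that interaction_push[where \<Psi> = \<Psi>, OF g _ anti, of v s] profile_push[OF g, of v s]
        nn_integral_push[OF g, of v s]
      by (auto simp: X_def intro: order_trans)
  qed
  have "\<exists>g\<in>X. (\<integral>\<^sup>+x. ennreal (g x) * indicator (- ?B) x \<partial>lborel) \<le> ennreal \<delta>"
  proof (rule ccontr)
    assume "\<not> ?thesis"
    then have far: "ennreal \<delta> \<le> (\<integral>\<^sup>+x. ennreal (g x) * indicator (- ?B) x \<partial>lborel)" if "g \<in> X" for g
      using that by (metis linear)
    have step: "\<exists>g'\<in>X. (\<integral>\<^sup>+x. ennreal (g x) * indicator ?B x \<partial>lborel) + ennreal \<eta>
        \<le> (\<integral>\<^sup>+x. ennreal (g' x) * indicator ?B x \<partial>lborel)" if gX: "g \<in> X" for g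
    proof -
      have g: "profile g" and gV: "(\<integral>\<^sup>+x. ennreal (g x) \<partial>lborel) = ennreal V"
        and gM: "(\<integral>\<^sup>+x. ennreal (g0 x) * indicator (cball 0 M) x \<partial>lborel)
          \<le> (\<integral>\<^sup>+x. ennreal (g x) * indicator (cball 0 M) x \<partial>lborel)"
        using gX by (auto simp: X_def)
      note [measurable] = profileD(1)[OF g]
      let ?b = "\<integral>\<^sup>+x. ennreal (g x) * indicator ?B x \<partial>lborel"
      have "?b \<le> ennreal V"
        unfolding gV[symmetric] by (intro nn_integral_mono) (auto simp: indicator_def)
      then have fin: "?b \<noteq> \<infinity>" by (auto simp: top_unique)
      have out: "?b + (\<integral>\<^sup>+x. ennreal (g x) * indicator (- ?B) x \<partial>lborel) = ennreal V"
        unfolding gV[symmetric]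
        by (subst nn_integral_add[symmetric]) (auto intro!: nn_integral_cong simp: indicator_def)
      then have bd: "?b + ennreal \<delta> \<le> ennreal V"
        using add_left_mono[OF far[OF gX], of ?b] by simp
      \<comment> \<open>The total mass equals the volume of the ball, so the room left inside equals
        the mass lying outside.\<close>
      have def: "?b + (\<integral>\<^sup>+x. ennreal (1 - g x) * indicator ?B x \<partial>lborel) = ennreal V"
        unfolding emV[symmetric]
        using profileD(2,3)[OF g]
        by (subst nn_integral_add[symmetric])
           (auto intro!: nn_integral_cong simp: indicator_def simp flip: ennreal_plus nn_integral_indicator)
      have M_out: "(\<integral>\<^sup>+x. ennreal (g x) * indicator (cball 0 M) x \<partial>lborel)
        \<le> ?b + (\<integral>\<^sup>+x. ennreal (g x) * indicator (cball 0 M - ?B) x \<partial>lborel)"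
        by (subst nn_integral_add[symmetric]) (auto intro!: nn_integral_mono simp: indicator_def)
      \<comment> \<open>Of the mass \<open>\<delta>\<close> outside the ball, at most one half can
        lie beyond radius \<open>M\<close>; the other half is in the shell.\<close>
      have half: "ennreal \<delta> = ennreal (\<delta> / 2) + ennreal (\<delta> / 2)"
        using \<open>0 < \<delta>\<close> by (simp flip: ennreal_plus)
      have "?b + ennreal \<delta> \<le> ?b + (\<integral>\<^sup>+x. ennreal (1 - g x) * indicator ?B x \<partial>lborel)"
        using bd unfolding def .
      then have "ennreal \<delta> \<le> (\<integral>\<^sup>+x. ennreal (1 - g x) * indicator ?B x \<partial>lborel)"
        using fin by (simp only: ennreal_add_left_cancel_le) simp
      then have 1: "ennreal (\<delta> / 2) \<le> (\<integral>\<^sup>+x. ennreal (1 - g x) * indicator ?B x \<partial>lborel)"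
        using \<open>0 < \<delta>\<close> by (elim order_trans[rotated]) (intro ennreal_leI, simp)
      have "(?b + ennreal (\<delta> / 2)) + ennreal (\<delta> / 2) \<le> ennreal V"
        using bd by (simp only: half add.assoc)
      also have "\<dots> \<le> (\<integral>\<^sup>+x. ennreal (g x) * indicator (cball 0 M) x \<partial>lborel) + ennreal (\<delta> / 2)"
        using tail gM by (blast intro: order_trans add_right_mono)
      also have "\<dots> \<le> ?b + (\<integral>\<^sup>+x. ennreal (g x) * indicator (cball 0 M - ?B) x \<partial>lborel) + ennreal (\<delta> / 2)"
        by (intro add_right_mono M_out)
      finally have "ennreal (\<delta> / 2) + (?b + ennreal (\<delta> / 2))
          \<le> ennreal (\<delta> / 2) + (?b + (\<integral>\<^sup>+x. ennreal (g x) * indicator (cball 0 M - ?B) x \<partial>lborel))"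
        by (simp only: add.commute add.left_commute)
      then have "ennreal (\<delta> / 2) \<le> (\<integral>\<^sup>+x. ennreal (g x) * indicator (cball 0 M - ?B) x \<partial>lborel)"
        using fin by (simp only: ennreal_add_left_cancel_le) auto
      from gain[rule_format, OF g 1 this] push_X[OF gX] show ?thesis by blast
    qed
    have "\<exists>g\<in>X. of_nat n * ennreal \<eta> \<le> (\<integral>\<^sup>+x. ennreal (g x) * indicator ?B x \<partial>lborel)" for n
    proof (induction n)
      case 0
      then show ?case using X0 by auto
    next
      case (Suc n)
      then obtain g where g: "g \<in> X" "of_nat n * ennreal \<eta> \<le> (\<integral>\<^sup>+x. ennreal (g x) * indicator ?B x \<partial>lborel)"
        by blast
      obtain g' where g': "g' \<in> X" "(\<integral>\<^sup>+x. ennreal (g x) * indicator ?B x \<partial>lborel) + ennreal \<eta>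
        \<le> (\<integral>\<^sup>+x. ennreal (g' x) * indicator ?B x \<partial>lborel)"
        using step[OF g(1)] by blast
      have "of_nat (Suc n) * ennreal \<eta> = of_nat n * ennreal \<eta> + ennreal \<eta>"
        by (simp add: algebra_simps)
      also have "\<dots> \<le> (\<integral>\<^sup>+x. ennreal (g' x) * indicator ?B x \<partial>lborel)"
        by (rule order_trans[OF add_right_mono[OF g(2)] g'(2)])
      finally show ?case using g'(1) by blast
    qed
    moreover have "(\<integral>\<^sup>+x. ennreal (g x) * indicator ?B x \<partial>lborel) \<le> ennreal V" if "g \<in> X" for g
    proof -
      have "ennreal V = (\<integral>\<^sup>+x. ennreal (g x) \<partial>lborel)" using that by (simp add: X_def)
      then show ?thesis by (simp only:) (intro nn_integral_mono, auto simp: indicator_def)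
    qed
    ultimately have "of_nat n * ennreal \<eta> \<le> ennreal V" for n
      by (meson order_trans)
    then have "real n * \<eta> \<le> V" for n
      using \<eta> V0 by (simp add: ennreal_of_nat_eq_real_of_nat flip: ennreal_mult)
    moreover obtain n where "V < real n * \<eta>" using reals_Archimedean3[OF \<eta>] by blast
    ultimately show False by (meson not_less)
  qed
  then obtain g where "g \<in> X" "(\<integral>\<^sup>+x. ennreal (g x) * indicator (- ?B) x \<partial>lborel) \<le> ennreal \<delta>"
    by blast
  then show ?thesis by (intro that[of g]) (auto simp: X_def emV)
qed

lemma profile_indicator: "A \<in> sets borel \<Longrightarrow> profile (indicator A :: 'a::euclidean_space \<Rightarrow> real)"
  by (auto simp: profile_def indicator_def)

text \<open>A concentrated \<open>h\<close> is at most the indicator of the ball plus its small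
  outer part, and against a potential bounded by \<open>C\<close> that part costs at most
  \<open>C\<close> times its mass. The two arguments are replaced one after the other.\<close>

lemma interaction_le_cball:
  fixes g :: "'a::euclidean_space \<Rightarrow> real"
  assumes g: "profile g" and V: "(\<integral>\<^sup>+x. ennreal (g x) \<partial>lborel) = emeasure lborel (cball (0::'a) R)"
    and "0 \<le> R" and [measurable]: "\<Psi> \<in> borel_measurable borel"
    and anti: "\<And>r t. 0 \<le> r \<Longrightarrow> r \<le> t \<Longrightarrow> \<Psi> t \<le> \<Psi> r"
    and bound: "\<And>(h :: 'a \<Rightarrow> real) x. profile h \<Longrightarrow> (\<integral>\<^sup>+y. ennreal (h y) \<partial>lborel) = emeasure lborel (cball (0::'a) R) \<Longrightarrow>
      (\<integral>\<^sup>+y. \<Psi> (norm (x - y)) * ennreal (h y) \<partial>lborel) \<le> ennreal C"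
  shows "interaction \<Psi> g g \<le> interaction \<Psi> (indicator (cball (0::'a) R)) (indicator (cball 0 R))"
proof (rule ennreal_le_epsilon)
  let ?B = "cball 0 R :: 'a set" and ?b = "indicator (cball 0 R) :: 'a \<Rightarrow> real"
  have B [measurable]: "?B \<in> sets borel" "- ?B \<in> sets borel" by auto
  have b: "profile ?b" by (rule profile_indicator) simp
  have bV: "(\<integral>\<^sup>+x. ennreal (?b x) \<partial>lborel) = emeasure lborel ?B"
  proof -
    have "ennreal (?b x) = indicator ?B x" for x by (simp add: indicator_def)
    then show ?thesis by simp
  qed
  fix e :: real
  assume "0 < e"
  \<comment> \<open>Two replacements cost \<open>\<bar>C\<bar> * \<delta>\<close> each, together at
    most \<open>e\<close>.\<close>
  define \<delta> where "\<delta> = e / (2 * (\<bar>C\<bar> + 1))"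
  have \<delta>: "0 < \<delta>" using \<open>0 < e\<close> by (simp add: \<delta>_def add_pos_nonneg)
  obtain h where h: "profile h" "interaction \<Psi> g g \<le> interaction \<Psi> h h"
    "(\<integral>\<^sup>+x. ennreal (h x) \<partial>lborel) = emeasure lborel ?B"
    "(\<integral>\<^sup>+x. ennreal (h x) * indicator (- ?B) x \<partial>lborel) \<le> ennreal \<delta>"
    by (rule exists_concentrated[where \<Psi> = \<Psi>, OF g V \<open>0 \<le> R\<close> \<delta> assms(4)]) (rule anti)
  note [measurable] = profileD(1)[OF h(1)] profileD(1)[OF b]
  have one: "interaction \<Psi> h k \<le> interaction \<Psi> ?b k + ennreal (\<bar>C\<bar> * \<delta>)"
    if k: "profile k" "(\<integral>\<^sup>+x. ennreal (k x) \<partial>lborel) = emeasure lborel ?B" for k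
  proof -
    note [measurable] = profileD(1)[OF k(1)]
    have eq: "interaction \<Psi> l k = (\<integral>\<^sup>+x. ennreal (l x) * (\<integral>\<^sup>+y. \<Psi> (norm (x - y)) * ennreal (k y) \<partial>lborel) \<partial>lborel)"
      if "profile l" for l
      unfolding interaction_def by (simp add: nn_integral_cmult[symmetric] mult_ac)
    have "interaction \<Psi> h k \<le> (\<integral>\<^sup>+x. ennreal (?b x) * (\<integral>\<^sup>+y. \<Psi> (norm (x - y)) * ennreal (k y) \<partial>lborel)
       + (ennreal (h x) * indicator (- ?B) x) * ennreal \<bar>C\<bar> \<partial>lborel)"
      unfolding eq[OF h(1)]
    proof (rule nn_integral_mono)
      fix x
      let ?I = "\<integral>\<^sup>+y. \<Psi> (norm (x - y)) * ennreal (k y) \<partial>lborel"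
      have "?I \<le> ennreal \<bar>C\<bar>"
        using bound[OF k, of x] by (rule order_trans) (intro ennreal_leI, simp)
      moreover have "ennreal (h x) * ?I \<le> 1 * ?I"
        using profileD[OF h(1)] by (intro mult_right_mono) auto
      ultimately show "ennreal (h x) * ?I \<le> ennreal (?b x) * ?I + (ennreal (h x) * indicator (- ?B) x) * ennreal \<bar>C\<bar>"
        by (cases "x \<in> ?B") (auto intro: mult_left_mono)
    qed
    also have "\<dots> = interaction \<Psi> ?b k + (\<integral>\<^sup>+x. ennreal (h x) * indicator (- ?B) x \<partial>lborel) * ennreal \<bar>C\<bar>"
      unfolding eq[OF b] by (subst nn_integral_add) (auto simp: nn_integral_multc)
    also have "\<dots> \<le> interaction \<Psi> ?b k + ennreal \<delta> * ennreal \<bar>C\<bar>"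
      by (intro add_left_mono mult_right_mono h(4)) simp
    also have "ennreal \<delta> * ennreal \<bar>C\<bar> = ennreal (\<bar>C\<bar> * \<delta>)"
      using \<delta> by (simp add: mult.commute flip: ennreal_mult)
    finally show ?thesis .
  qed
  have sym: "interaction \<Psi> ?b h = interaction \<Psi> h ?b"
  proof -
    have "interaction \<Psi> ?b h = (\<integral>\<^sup>+x. \<integral>\<^sup>+y. \<Psi> (norm (y - x)) * (ennreal (?b y) * ennreal (h x)) \<partial>lborel \<partial>lborel)"
      unfolding interaction_def by (rule lborel_pair.Fubini') measurable
    also have "\<dots> = interaction \<Psi> h ?b"
      unfolding interaction_def
    proof (intro nn_integral_cong)
      fix x y :: 'a
      show "\<Psi> (norm (y - x)) * (ennreal (?b y) * ennreal (h x))
          = \<Psi> (norm (x - y)) * (ennreal (h x) * ennreal (?b y))"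
        by (simp only: norm_minus_commute[of y x] mult.commute[of "ennreal (?b y)"])
    qed
    finally show ?thesis .
  qed
  have "interaction \<Psi> g g \<le> interaction \<Psi> h h" by (rule h(2))
  also have "\<dots> \<le> interaction \<Psi> h ?b + ennreal (\<bar>C\<bar> * \<delta>)" using one[OF h(1,3)] unfolding sym .
  also have "\<dots> \<le> interaction \<Psi> ?b ?b + ennreal (\<bar>C\<bar> * \<delta>) + ennreal (\<bar>C\<bar> * \<delta>)"
    by (rule add_right_mono[OF one[OF b bV]])
  also have "\<dots> = interaction \<Psi> ?b ?b + ennreal (2 * (\<bar>C\<bar> * \<delta>))"
    using \<delta> by (simp add: add.assoc flip: ennreal_plus)
  also have "\<dots> \<le> interaction \<Psi> ?b ?b + ennreal e"
  proof (intro add_left_mono ennreal_leI)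
    have "2 * (\<bar>C\<bar> * \<delta>) \<le> \<delta> * (2 * (\<bar>C\<bar> + 1))" using \<delta> by (simp add: algebra_simps)
    also have "\<dots> = e" by (simp add: \<delta>_def)
    finally show "2 * (\<bar>C\<bar> * \<delta>) \<le> e" .
  qed
  finally show "interaction \<Psi> g g \<le> interaction \<Psi> ?b ?b + ennreal e" .
qed


subsection \<open>Lebesgue measurable functions and the energy\<close>

lemma AE_lborel_reflect:
  fixes P :: "'a::euclidean_space \<Rightarrow> bool"
  assumes "AE k in lborel. P k"
  shows "AE y in lborel. P (x - y)"
proof -
  obtain N where N: "{k \<in> space lborel. \<not> P k} \<subseteq> N" "emeasure lborel N = 0" "N \<in> sets lborel"
    using assms by (rule AE_E)
  then have [measurable]: "N \<in> sets borel" by simp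
  have "(\<integral>\<^sup>+y. indicator N (x - y) \<partial>lborel) = 0"
    using nn_integral_lborel_shift(2)[of "indicator N" x] N(2) by simp
  then have "AE y in lborel. indicator N (x - y) = (0::ennreal)"
    by (subst (asm) nn_integral_0_iff_AE) measurable
  then show ?thesis
  proof (rule AE_mp, intro AE_I2 impI)
    fix y assume "indicator N (x - y) = (0::ennreal)"
    then show "P (x - y)" using N(1) by (auto simp: indicator_def split: if_splits)
  qed
qed

lemma AE_lborel_pair:
  fixes P :: "'a::euclidean_space \<Rightarrow> bool"
  assumes P: "AE k in lborel. P k"
  shows "AE p in (lborel :: ('a \<times> 'a) measure). P (fst p) \<and> P (snd p)"
    and "AE p in (lborel :: ('a \<times> 'a) measure). P (fst p - snd p)"
proof -
  obtain N where N: "{k \<in> space lborel. \<not> P k} \<subseteq> N" "emeasure lborel N = 0" "N \<in> sets lborel"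
    using P by (rule AE_E)
  then have [measurable]: "N \<in> sets borel" by simp
  have AE: "AE k in lborel. k \<notin> N"
    using N by (intro AE_not_in) (auto simp: null_sets_def)
  have "AE p in lborel \<Otimes>\<^sub>M lborel. fst p \<notin> N \<and> snd p \<notin> N"
    by (rule lborel_pair.AE_pair_measure) (measurable, use AE in auto)
  then show "AE p in (lborel :: ('a \<times> 'a) measure). P (fst p) \<and> P (snd p)"
    unfolding lborel_prod by (rule AE_mp) (use N(1) in \<open>auto intro!: AE_I2\<close>)
  have "AE p in lborel \<Otimes>\<^sub>M lborel. fst p - snd p \<notin> N"
  proof (rule lborel_pair.AE_pair_measure)
    show "{p \<in> space (lborel \<Otimes>\<^sub>M lborel). fst p - snd p \<notin> N} \<in> sets (lborel \<Otimes>\<^sub>M lborel)"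
      by measurable
    show "AE x in lborel. AE y in lborel. fst (x, y) - snd (x, y) \<notin> N"
      using AE_lborel_reflect[OF AE] by auto
  qed
  then show "AE p in (lborel :: ('a \<times> 'a) measure). P (fst p - snd p)"
    unfolding lborel_prod by (rule AE_mp) (use N(1) in \<open>auto intro!: AE_I2\<close>)
qed

text \<open>In the completion every subset of the exceptional null set is measurable, whatever
  \<open>f\<close> does there. This gives measurability of the exchange integrand, in which
  \<open>w\<close> and \<open>g\<close> are known only up to null sets.\<close>

lemma measurable_completion_cong_AE:
  assumes [measurable]: "f' \<in> measurable M N" and AE: "AE x in M. f x = f' x" and "\<And>x. f x \<in> space N"
  shows "f \<in> measurable (completion M) N"
proof (rule measurableI)
  fix A assume [measurable]: "A \<in> sets N"
  have [measurable]: "f' \<in> measurable (completion M) N" by (rule measurable_completion) measurable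
  have [measurable]: "Measurable.pred (completion M) (\<lambda>x. f x \<noteq> f' x)"
    "Measurable.pred (completion M) (\<lambda>x. f x \<noteq> f' x \<and> f x \<in> A)"
    by (rule sets_completion_AE, use AE in auto)+
  have "f -` A \<inter> space (completion M) =
      {x \<in> space (completion M). (\<not> f x \<noteq> f' x \<and> f' x \<in> A) \<or> (f x \<noteq> f' x \<and> f x \<in> A)}"
    by auto
  also have "\<dots> \<in> sets (completion M)" by measurable
  finally show "f -` A \<inter> space (completion M) \<in> sets (completion M)" .
qed (use assms in auto)

text \<open>Both sides are 0 if the interaction is infinite, by the conventions for
  \<open>enn2real\<close> and for integrals of non-integrable functions;
  \<open>interaction_finite\<close> supplies finiteness separately.\<close>

lemma exchange_integral_eq:
  fixes w :: "'a::euclidean_space \<Rightarrow> real" and g h :: "'a \<Rightarrow> real"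
  assumes h: "profile h" and gh: "AE k in lborel. g k = h k"
    and [measurable]: "\<Psi> \<in> borel_measurable borel"
    and w: "AE k in lborel. 0 \<le> w k \<and> ennreal (w k) = \<Psi> (norm k)"
  shows "(LINT p|(lebesgue :: ('a \<times> 'a) measure). w (fst p - snd p) * g (fst p) * g (snd p))
    = enn2real (interaction \<Psi> h h)"
proof -
  note [measurable] = profileD(1)[OF h]
  let ?f = "\<lambda>p::'a \<times> 'a. w (fst p - snd p) * g (fst p) * g (snd p)"
  let ?f' = "\<lambda>p::'a \<times> 'a. enn2real (\<Psi> (norm (fst p - snd p))) * h (fst p) * h (snd p)"
  have AE: "AE p in lborel. ?f p = ?f' p \<and>
      ennreal (?f' p) = \<Psi> (norm (fst p - snd p)) * (ennreal (h (fst p)) * ennreal (h (snd p)))"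
    using AE_lborel_pair(1)[OF gh] AE_lborel_pair(2)[OF w]
  proof eventually_elim
    case (elim p)
    then have "\<Psi> (norm (fst p - snd p)) = ennreal (w (fst p - snd p))" by simp
    with elim show ?case
      using profileD(2)[OF h] by (simp add: ennreal_mult mult.assoc)
  qed
  have "?f' \<in> borel_measurable (lborel \<Otimes>\<^sub>M lborel)"
    by measurable
  then have f' [measurable]: "?f' \<in> borel_measurable lborel"
    unfolding lborel_prod .
  have f: "?f \<in> borel_measurable lebesgue"
    using AE by (intro measurable_completion_cong_AE[OF f']) auto
  have "(LINT p|lebesgue. ?f p) = (LINT p|lebesgue. ?f' p)"
    by (rule integral_cong_AE[OF f measurable_completion[OF f'] AE_completion]) (use AE in auto)
  also have "\<dots> = (LINT p|lborel. ?f' p)"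
    by (rule integral_completion[OF f'])
  also have "\<dots> = enn2real (\<integral>\<^sup>+p. ennreal (?f' p) \<partial>lborel)"
    using profileD(2)[OF h] by (intro integral_eq_nn_integral f') auto
  also have "(\<integral>\<^sup>+p. ennreal (?f' p) \<partial>lborel)
      = (\<integral>\<^sup>+p. \<Psi> (norm (fst p - snd p)) * (ennreal (h (fst p)) * ennreal (h (snd p))) \<partial>(lborel \<Otimes>\<^sub>M lborel))"
    unfolding lborel_prod using AE by (intro nn_integral_cong_AE) auto
  also have "\<dots> = interaction \<Psi> h h"
    unfolding interaction_def by (subst lborel.nn_integral_fst[symmetric]) simp_all
  finally show ?thesis .
qed

lemma interaction_finite:
  fixes h :: "'a::euclidean_space \<Rightarrow> real"
  assumes h: "profile h" and [measurable]: "\<Psi> \<in> borel_measurable borel"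
    and V: "(\<integral>\<^sup>+x. ennreal (h x) \<partial>lborel) = ennreal V"
    and bound: "\<And>x. (\<integral>\<^sup>+y. \<Psi> (norm (x - y)) * ennreal (h y) \<partial>lborel) \<le> ennreal C"
  shows "interaction \<Psi> h h < \<infinity>"
proof -
  note [measurable] = profileD(1)[OF h]
  have "interaction \<Psi> h h = (\<integral>\<^sup>+x. ennreal (h x) * (\<integral>\<^sup>+y. \<Psi> (norm (x - y)) * ennreal (h y) \<partial>lborel) \<partial>lborel)"
    unfolding interaction_def by (simp add: nn_integral_cmult[symmetric] mult_ac)
  also have "\<dots> \<le> (\<integral>\<^sup>+x. ennreal (h x) * ennreal C \<partial>lborel)"
    by (intro nn_integral_mono mult_left_mono bound) simp
  also have "\<dots> = ennreal V * ennreal C"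
    by (simp add: nn_integral_multc V)
  also have "\<dots> < \<infinity>" by (simp add: ennreal_mult_less_top)
  finally show ?thesis .
qed

text \<open>The integrable part of \<open>w\<close> is controlled by \<open>h \<le> 1\<close>, the
  bounded part by the total mass \<open>V\<close>. The resulting bound is uniform in
  \<open>x\<close> and \<open>h\<close>.\<close>

lemma potential_bound:
  fixes w :: "'a::euclidean_space \<Rightarrow> real"
  assumes "L1_plus_Linf w" and w: "AE k in lborel. ennreal (w k) = \<Psi> (norm k)"
    and [measurable]: "\<Psi> \<in> borel_measurable borel" and "0 \<le> V"
  obtains C where "\<And>(h :: 'a \<Rightarrow> real) x. profile h \<Longrightarrow> (\<integral>\<^sup>+y. ennreal (h y) \<partial>lborel) = ennreal V \<Longrightarrow>
      (\<integral>\<^sup>+y. \<Psi> (norm (x - y)) * ennreal (h y) \<partial>lborel) \<le> ennreal C"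
proof -
  obtain u v K where u: "integrable lebesgue u" and v: "AE k in lebesgue. \<bar>v k\<bar> \<le> K"
    and uv: "AE k in lebesgue. w k = u k + v k"
    using assms(1) unfolding L1_plus_Linf_def by blast
  have um [measurable]: "u \<in> borel_measurable lebesgue" using u by simp
  have ufin: "(\<integral>\<^sup>+k. ennreal \<bar>u k\<bar> \<partial>lebesgue) < \<infinity>"
    using u by (simp add: integrable_iff_bounded)
  then obtain U where U: "0 \<le> U" "(\<integral>\<^sup>+k. ennreal \<bar>u k\<bar> \<partial>lebesgue) = ennreal U"
    by (cases "\<integral>\<^sup>+k. ennreal \<bar>u k\<bar> \<partial>lebesgue") auto
  have "(\<integral>\<^sup>+y. \<Psi> (norm (x - y)) * ennreal (h y) \<partial>lborel) \<le> ennreal (U + \<bar>K\<bar> * V)"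
    if h: "profile h" and hV: "(\<integral>\<^sup>+y. ennreal (h y) \<partial>lborel) = ennreal V" for h :: "'a \<Rightarrow> real" and x
  proof -
    note [measurable] = profileD(1)[OF h]
    have hx: "(\<lambda>z. ennreal (h (x - z))) \<in> borel_measurable lebesgue"
      by (rule measurable_completion) measurable
    have "(\<integral>\<^sup>+y. \<Psi> (norm (x - y)) * ennreal (h y) \<partial>lborel)
       = (\<integral>\<^sup>+z. \<Psi> (norm z) * ennreal (h (x - z)) \<partial>lborel)"
      using nn_integral_lborel_shift(2)[of "\<lambda>z. \<Psi> (norm z) * ennreal (h (x - z))" x] by simp
    also have "\<dots> = (\<integral>\<^sup>+z. \<Psi> (norm z) * ennreal (h (x - z)) \<partial>lebesgue)"
      by (simp add: nn_integral_completion)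
    also have "\<dots> \<le> (\<integral>\<^sup>+z. ennreal \<bar>u z\<bar> + ennreal \<bar>K\<bar> * ennreal (h (x - z)) \<partial>lebesgue)"
    proof (rule nn_integral_mono_AE)
      show "AE z in lebesgue. \<Psi> (norm z) * ennreal (h (x - z)) \<le> ennreal \<bar>u z\<bar> + ennreal \<bar>K\<bar> * ennreal (h (x - z))"
        using v uv AE_completion[OF w]
      proof eventually_elim
        case (elim z)
        have "\<Psi> (norm z) \<le> ennreal (\<bar>u z\<bar> + \<bar>K\<bar>)"
          unfolding elim(3)[symmetric] using elim(1,2) by (intro ennreal_leI) linarith
        then have "\<Psi> (norm z) * ennreal (h (x - z)) \<le> (ennreal \<bar>u z\<bar> + ennreal \<bar>K\<bar>) * ennreal (h (x - z))"
          by (intro mult_right_mono) simp_all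
        also have "\<dots> = ennreal \<bar>u z\<bar> * ennreal (h (x - z)) + ennreal \<bar>K\<bar> * ennreal (h (x - z))"
          by (simp add: distrib_right)
        also have "\<dots> \<le> ennreal \<bar>u z\<bar> * 1 + ennreal \<bar>K\<bar> * ennreal (h (x - z))"
          using profileD(3)[OF h] by (intro add_right_mono mult_left_mono) auto
        finally show ?case by simp
      qed
    qed
    also have "\<dots> = ennreal U + ennreal \<bar>K\<bar> * (\<integral>\<^sup>+z. ennreal (h (x - z)) \<partial>lebesgue)"
      using hx by (simp add: nn_integral_add nn_integral_cmult U)
    also have "(\<integral>\<^sup>+z. ennreal (h (x - z)) \<partial>lebesgue) = ennreal V"
      using nn_integral_lborel_shift(2)[of "\<lambda>y. ennreal (h y)" x] hV by (simp add: nn_integral_completion)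
    finally show ?thesis
      using U \<open>0 \<le> V\<close> by (simp add: ennreal_mult)
  qed
  then show ?thesis using that by blast
qed

lemma radial_profile:
  fixes w :: "'a::euclidean_space \<Rightarrow> real"
  assumes "radial_nonincreasing w"
  obtains \<Psi> :: "real \<Rightarrow> ennreal" where "\<Psi> \<in> borel_measurable borel"
    "\<And>r t. 0 \<le> r \<Longrightarrow> r \<le> t \<Longrightarrow> \<Psi> t \<le> \<Psi> r" "AE k in lborel. ennreal (w k) = \<Psi> (norm k)"
proof -
  obtain \<phi> where anti: "antimono_on {0<..} \<phi>" and w: "AE k in lebesgue. w k = \<phi> (norm k)"
    using assms unfolding radial_nonincreasing_def by blast
  \<comment> \<open>The value \<open>top\<close> at \<open>0\<close> makes the profile monotone up to the origin, where \<open>\<phi>\<close> is arbitrary.\<close>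
  define \<Psi> where "\<Psi> r = (if r \<le> 0 then top else ennreal (\<phi> r))" for r :: real
  \<comment> \<open>The sign turns the profile into a function that is increasing on each of the two
    pieces.\<close>
  have "(\<lambda>r. if r \<le> 0 then 0 else - \<phi> r) \<in> borel_measurable borel"
    using anti by (intro borel_measurable_piecewise_mono[of "{{..0}, {0<..}}"]) (auto simp: monotone_on_def)
  then have "(\<lambda>r. ennreal (- (if r \<le> 0 then 0 else - \<phi> r))) \<in> borel_measurable borel"
    by measurable
  then have "(\<lambda>r. if r \<le> 0 then top else ennreal (- (if r \<le> 0 then 0 else - \<phi> r))) \<in> borel_measurable borel"
    by measurable
  also have "(\<lambda>r. if r \<le> 0 then top else ennreal (- (if r \<le> 0 then 0 else - \<phi> r))) = \<Psi>"
    by (auto simp: \<Psi>_def fun_eq_iff)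
  finally have "\<Psi> \<in> borel_measurable borel" .
  moreover have "\<Psi> t \<le> \<Psi> r" if "0 \<le> r" "r \<le> t" for r t
    using that anti by (auto simp: \<Psi>_def monotone_on_def intro: ennreal_leI)
  moreover have "AE k in lborel. ennreal (w k) = \<Psi> (norm k)"
    using w[unfolded AE_completion_iff] AE_lborel_singleton[of "0::'a"]
    by eventually_elim (simp add: \<Psi>_def)
  ultimately show ?thesis using that by blast
qed

text \<open>The product of \<open>(norm k)\<^sup>2 - R\<^sup>2\<close> and \<open>g k - b k\<close>
  is nonnegative everywhere. Equality of the masses turns its integral into the difference of the
  kinetic terms; if that is not positive, the product vanishes almost everywhere.\<close>

lemma bathtub:
  fixes g :: "'a::euclidean_space \<Rightarrow> real"
  assumes g: "profile g" and "0 \<le> R"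
    and V: "(\<integral>\<^sup>+x. ennreal (g x) \<partial>lborel) = emeasure lborel (cball (0::'a) R)"
  defines "b \<equiv> indicator (cball 0 R) :: 'a \<Rightarrow> real"
    and "K \<equiv> \<lambda>h :: 'a \<Rightarrow> real. \<integral>\<^sup>+k. ennreal ((norm k)\<^sup>2 * h k) \<partial>lborel"
  shows "K b \<le> K g" and "K b < \<infinity>" and "K g \<le> K b \<Longrightarrow> AE k in lborel. g k = b k"
proof -
  have b: "profile b" unfolding b_def by (rule profile_indicator) simp
  note [measurable] = profileD(1)[OF g] profileD(1)[OF b]
  have bV: "(\<integral>\<^sup>+x. ennreal (b x) \<partial>lborel) = emeasure lborel (cball (0::'a) R)"
  proof -
    have "ennreal (b x) = indicator (cball 0 R) x" for x by (simp add: indicator_def b_def)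
    then show ?thesis by simp
  qed
  have fin: "emeasure lborel (cball (0::'a) R) < \<infinity>"
    using \<open>0 \<le> R\<close> by (simp add: emeasure_cball)
  \<comment> \<open>The product is split into two nonnegative sums, so that an infinite kinetic
    integral of \<open>g\<close> is covered.\<close>
  let ?F = "\<lambda>k. ennreal ((norm k)\<^sup>2 * b k + R\<^sup>2 * g k)" and ?G = "\<lambda>k. ennreal ((norm k)\<^sup>2 * g k + R\<^sup>2 * b k)"
  have int: "(\<integral>\<^sup>+k. ennreal ((norm k)\<^sup>2 * h k + R\<^sup>2 * l k) \<partial>lborel)
      = K h + ennreal (R\<^sup>2) * (\<integral>\<^sup>+x. ennreal (l x) \<partial>lborel)" if "profile h" "profile l" for h l
  proof -
    note [measurable] = profileD(1)[OF that(1)] profileD(1)[OF that(2)]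
    have "(\<integral>\<^sup>+k. ennreal ((norm k)\<^sup>2 * h k + R\<^sup>2 * l k) \<partial>lborel)
      = (\<integral>\<^sup>+k. ennreal ((norm k)\<^sup>2 * h k) + ennreal (R\<^sup>2) * ennreal (l k) \<partial>lborel)"
      using profileD(2)[OF that(1)] profileD(2)[OF that(2)]
      by (intro nn_integral_cong) (simp add: ennreal_mult)
    then show ?thesis by (simp add: K_def nn_integral_add nn_integral_cmult)
  qed
  let ?c = "ennreal (R\<^sup>2) * emeasure lborel (cball (0::'a) R)"
  have c: "?c \<noteq> \<infinity>" using fin by (simp add: ennreal_mult_eq_top_iff)
  have F: "(\<integral>\<^sup>+k. ?F k \<partial>lborel) = K b + ?c" and G: "(\<integral>\<^sup>+k. ?G k \<partial>lborel) = K g + ?c"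
    using int[OF b g] int[OF g b] by (simp_all add: V bV)
  have pt: "(norm k)\<^sup>2 * b k + R\<^sup>2 * g k \<le> (norm k)\<^sup>2 * g k + R\<^sup>2 * b k" for k
  proof (cases "norm k \<le> R")
    case True
    then have "(norm k)\<^sup>2 \<le> R\<^sup>2" by (intro power_mono) auto
    then have "((norm k)\<^sup>2 - R\<^sup>2) * (1 - g k) \<le> 0"
      using profileD(3)[OF g] by (intro mult_nonpos_nonneg) auto
    with True show ?thesis by (simp add: b_def algebra_simps)
  next
    case False
    then have "R\<^sup>2 \<le> (norm k)\<^sup>2" using \<open>0 \<le> R\<close> by (intro power_mono) auto
    with False show ?thesis using profileD(2)[OF g] by (simp add: b_def mult_right_mono)
  qed
  have "K b + ?c \<le> K g + ?c"
    unfolding F[symmetric] G[symmetric] by (intro nn_integral_mono ennreal_leI pt)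
  then show "K b \<le> K g" using c by (simp add: add.commute[of _ ?c] del: infinity_ennreal_def)
  have "K b \<le> (\<integral>\<^sup>+k. ennreal (R\<^sup>2) * ennreal (b k) \<partial>lborel)"
    unfolding K_def
  proof (rule nn_integral_mono)
    fix k
    have "(norm k)\<^sup>2 * b k \<le> R\<^sup>2 * b k"
      by (cases "norm k \<le> R") (auto simp: b_def power_mono)
    then show "ennreal ((norm k)\<^sup>2 * b k) \<le> ennreal (R\<^sup>2) * ennreal (b k)"
      using profileD(2)[OF b] by (simp add: ennreal_leI flip: ennreal_mult)
  qed
  also have "\<dots> = ?c" by (simp add: nn_integral_cmult bV)
  also have "\<dots> < \<infinity>" using c by (simp add: less_top)
  finally show Kb: "K b < \<infinity>" .
  assume "K g \<le> K b"
  then have "(\<integral>\<^sup>+k. ?G k \<partial>lborel) \<le> (\<integral>\<^sup>+k. ?F k \<partial>lborel)"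
    unfolding F G by (rule add_right_mono)
  moreover have Ffin: "(\<integral>\<^sup>+k. ?F k \<partial>lborel) \<noteq> \<infinity>"
    unfolding F using Kb c by simp
  ultimately have "(\<integral>\<^sup>+k. ?G k - ?F k \<partial>lborel) = 0"
    using pt by (subst nn_integral_diff) (auto simp: ennreal_leI diff_eq_0_iff_ennreal less_top)
  then have "AE k in lborel. ?G k - ?F k = 0"
    by (subst (asm) nn_integral_0_iff_AE) measurable
  \<comment> \<open>On the sphere the product vanishes for any value of \<open>g\<close>; the sphere
    is null.\<close>
  moreover have "AE k in lborel. norm (k::'a) \<noteq> R"
  proof -
    have "sphere (0::'a) R \<in> null_sets lebesgue"
      using negligible_convex_frontier[of "cball (0::'a) R"] by (simp add: negligible_iff_null_sets)
    then have "AE k in lebesgue. k \<notin> sphere (0::'a) R" by (rule AE_not_in)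
    then show ?thesis by (simp add: AE_completion_iff)
  qed
  ultimately show "AE k in lborel. g k = b k"
  proof eventually_elim
    case (elim k)
    have nn: "0 \<le> (norm k)\<^sup>2 * b k + R\<^sup>2 * g k" "0 \<le> (norm k)\<^sup>2 * g k + R\<^sup>2 * b k"
      using profileD(2)[OF g] profileD(2)[OF b] by auto
    have "ennreal (((norm k)\<^sup>2 * g k + R\<^sup>2 * b k) - ((norm k)\<^sup>2 * b k + R\<^sup>2 * g k)) = 0"
      using elim(1) nn by (simp add: ennreal_minus)
    then have "(norm k)\<^sup>2 * g k + R\<^sup>2 * b k \<le> (norm k)\<^sup>2 * b k + R\<^sup>2 * g k"
      by (simp add: ennreal_eq_0_iff)
    with pt[of k] have "((norm k)\<^sup>2 - R\<^sup>2) * (g k - b k) = 0"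
      by (simp add: algebra_simps)
    moreover have "(norm k)\<^sup>2 \<noteq> R\<^sup>2" using elim(2) \<open>0 \<le> R\<close> by (simp add: power2_eq_iff_nonneg)
    ultimately show ?case by simp
  qed
qed

section \<open>The Thomas-Fermi ball and admissible functions\<close>

lemma g_TF_eq_cball:
  assumes "0 \<le> \<rho>"
  obtains R where "0 \<le> R" "(g_TF \<rho> :: 'a::euclidean_space \<Rightarrow> real) = indicator (cball 0 R)"
    "emeasure lborel (cball (0::'a) R) = ennreal ((2 * pi) ^ DIM('a) * \<rho>)"
proof -
  let ?d = "real DIM('a)" and ?\<omega> = "unit_ball_vol (real DIM('a))"
  have d: "0 < ?d" by simp
  have \<omega>: "0 < ?\<omega>" by simp
  \<comment> \<open>Solves \<open>?\<omega> * R ^ DIM('a) = (2 * pi) ^ DIM('a) * \<rho>\<close>;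
    since the unit sphere has surface \<open>?d * ?\<omega>\<close>, its square is the threshold in
    \<open>g_TF\<close>.\<close>
  define R where "R = 2 * pi * (\<rho> / ?\<omega>) powr (1 / ?d)"
  have R: "0 \<le> R" by (simp add: R_def)
  have "surface_measure (sphere (0::'a) 1) = ?d * ?\<omega>"
    unfolding surface_measure_def by (intro tendsto_Lim tendsto_tube_unit_sphere) simp
  then have "c_TF TYPE('a) * \<rho> powr (2 / ?d) = 4 * pi\<^sup>2 * ((1 / ?\<omega>) powr (2 / ?d) * \<rho> powr (2 / ?d))"
    using d by (simp add: c_TF_def)
  also have "(1 / ?\<omega>) powr (2 / ?d) * \<rho> powr (2 / ?d) = (\<rho> / ?\<omega>) powr (2 / ?d)"
    using \<omega> assms by (subst powr_mult[symmetric]) auto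
  also have "\<dots> = ((\<rho> / ?\<omega>) powr (1 / ?d))\<^sup>2"
    by (simp add: power2_eq_square powr_add[symmetric])
  also have "4 * pi\<^sup>2 * \<dots> = R\<^sup>2" by (simp add: R_def power_mult_distrib)
  finally have c: "c_TF TYPE('a) * \<rho> powr (2 / ?d) = R\<^sup>2" .
  have "{k::'a. (norm k)\<^sup>2 \<le> R\<^sup>2} = cball 0 R"
    using R by (auto simp: power_mono dest: power2_le_imp_le)
  then have "(g_TF \<rho> :: 'a \<Rightarrow> real) = indicator (cball 0 R)"
    by (simp add: g_TF_def c)
  moreover have "?\<omega> * R ^ DIM('a) = (2 * pi) ^ DIM('a) * \<rho>"
  proof -
    have "((\<rho> / ?\<omega>) powr (1 / ?d)) ^ DIM('a) = \<rho> / ?\<omega>"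
    \<comment> \<open>For \<open>\<rho> = 0\<close> the convention \<open>0 powr x = 0\<close> gives
      radius 0, and the ball is a single point.\<close>
    proof (cases "\<rho> = 0")
      case False
      then have "0 < \<rho> / ?\<omega>" using assms \<omega> by simp
      then have "((\<rho> / ?\<omega>) powr (1 / ?d)) ^ DIM('a) = ((\<rho> / ?\<omega>) powr (1 / ?d)) powr ?d"
        by (intro powr_realpow[symmetric]) (metis powr_gt_zero less_irrefl)
      also have "\<dots> = \<rho> / ?\<omega>" using \<open>0 < \<rho> / ?\<omega>\<close> assms by (simp add: powr_powr)
      finally show ?thesis .
    qed (simp add: power_0_left)
    moreover have "?\<omega> \<noteq> 0" using \<omega> by (metis less_irrefl)
    ultimately show ?thesis by (simp add: R_def power_mult_distrib)
  qed
  then have "emeasure lborel (cball (0::'a) R) = ennreal ((2 * pi) ^ DIM('a) * \<rho>)"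
    using R by (simp add: emeasure_cball)
  ultimately show ?thesis using that R by blast
qed

lemma admissible_borel_profile:
  fixes g :: "'a::euclidean_space \<Rightarrow> real"
  assumes "g \<in> admissible \<rho>"
  obtains h where "profile h" "AE k in lborel. g k = h k"
    "(\<integral>\<^sup>+x. ennreal (h x) \<partial>lborel) = ennreal ((2 * pi) ^ DIM('a) * \<rho>)"
proof -
  have g: "g \<in> borel_measurable lebesgue" "\<And>k. 0 \<le> g k" "\<And>k. g k \<le> 1" "integrable lebesgue g"
    and "1 / (2 * pi) ^ DIM('a) * (LINT k|lebesgue. g k) = \<rho>"
    using assms by (auto simp: admissible_def)
  then have m: "(LINT k|lebesgue. g k) = (2 * pi) ^ DIM('a) * \<rho>"
    by (simp add: field_simps)
  obtain g' where g' [measurable]: "g' \<in> borel_measurable lborel" and eq: "AE k in lborel. g k = g' k"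
    using completion_ex_borel_measurable_real[OF g(1)] by blast
  \<comment> \<open>The Borel version agrees with \<open>g\<close> only almost everywhere; clipping
    restores the bounds at every point.\<close>
  define h where "h k = max 0 (min 1 (g' k))" for k
  have h: "profile h" using g' by (auto simp: profile_def h_def[abs_def])
  have gh: "AE k in lborel. g k = h k"
    using eq
  proof eventually_elim
    case (elim k)
    then show ?case using g(2)[of k] g(3)[of k] by (simp add: h_def)
  qed
  have "(\<integral>\<^sup>+x. ennreal (h x) \<partial>lborel) = (\<integral>\<^sup>+x. ennreal (g x) \<partial>lebesgue)"
    unfolding nn_integral_completion using gh by (intro nn_integral_cong_AE) auto
  also have "\<dots> = ennreal ((2 * pi) ^ DIM('a) * \<rho>)"
    using nn_integral_eq_integral[OF g(4)] g(2) m by simp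
  finally show ?thesis using that h gh by blast
qed

lemma admissible_ball:
  assumes "0 \<le> \<rho>" "emeasure lborel (cball (0::'a) R) = ennreal ((2 * pi) ^ DIM('a) * \<rho>)"
  shows "(indicator (cball 0 R) :: 'a::euclidean_space \<Rightarrow> real) \<in> admissible \<rho>"
proof -
  have "measure lebesgue (cball (0::'a) R) = (2 * pi) ^ DIM('a) * \<rho>"
    using assms by (simp add: measure_def)
  then show ?thesis
    using assms by (auto simp: admissible_def intro!: borel_measurable_indicator integrable_real_indicator)
qed

text \<open>At least one of the two differences is truncated to 0 by \<open>ennreal\<close>, so the
  exchange terms appear on the side where their difference is nonnegative. An infinite
  \<open>K'\<close> makes both inequalities true.\<close>

lemma HF_energy_le_iff:
  fixes a j j' :: real and K K' :: ennreal
  assumes "0 < a" "K < \<infinity>"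
  shows "ereal a * enn2ereal K - ereal (a * j) \<le> ereal a * enn2ereal K' - ereal (a * j')
    \<longleftrightarrow> K + ennreal (j' - j) \<le> K' + ennreal (j - j')"
proof -
  obtain k where k: "0 \<le> k" "K = ennreal k" using assms(2) by (cases K) auto
  show ?thesis
  proof (cases K')
    case (real k')
    have "a * k - a * j \<le> a * k' - a * j' \<longleftrightarrow> k - j \<le> k' - j'"
      using assms(1) by (simp flip: right_diff_distrib)
    moreover have "ennreal k + ennreal (j' - j) \<le> ennreal k' + ennreal (j - j') \<longleftrightarrow> k - j \<le> k' - j'"
      using k real by (cases "j \<le> j'") (auto simp: ennreal_neg simp flip: ennreal_plus)
    ultimately show ?thesis using k real by (simp add: enn2ereal_ennreal)
  next
    case top
    then show ?thesis using k assms by (simp add: enn2ereal_ennreal)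
  qed
qed

theorem theorem6:
  fixes w :: "'a::euclidean_space \<Rightarrow> real" and \<rho> :: real
  assumes "L1_plus_Linf w"
    and "AE k in lebesgue. 0 \<le> w k"
    and "radial_nonincreasing w"
    and "0 \<le> \<rho>"
  shows "is_no_spin_minimiser w \<rho> (g_TF \<rho>) \<and>
    (\<forall>g. is_no_spin_minimiser w \<rho> g \<longrightarrow> (AE k in lebesgue. g k = g_TF \<rho> k))"
proof -
  obtain R where R: "0 \<le> R" and gTF: "(g_TF \<rho> :: 'a \<Rightarrow> real) = indicator (cball 0 R)"
    and mass: "emeasure lborel (cball (0::'a) R) = ennreal ((2 * pi) ^ DIM('a) * \<rho>)"
    using g_TF_eq_cball[OF \<open>0 \<le> \<rho>\<close>] by blast
  define V where "V = (2 * pi) ^ DIM('a) * \<rho>"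
  have V: "0 \<le> V" using \<open>0 \<le> \<rho>\<close> by (simp add: V_def)
  define b where "b = (indicator (cball 0 R) :: 'a \<Rightarrow> real)"
  obtain \<Psi> where \<Psi>: "\<Psi> \<in> borel_measurable borel" and anti: "\<And>r t. 0 \<le> r \<Longrightarrow> r \<le> t \<Longrightarrow> \<Psi> t \<le> \<Psi> r"
    and w\<Psi>: "AE k in lborel. ennreal (w k) = \<Psi> (norm k)"
    using radial_profile[OF assms(3)] by blast
  have w: "AE k in lborel. 0 \<le> w k \<and> ennreal (w k) = \<Psi> (norm k)"
    using assms(2)[unfolded AE_completion_iff] w\<Psi> by eventually_elim simp
  obtain C where C: "\<And>(h :: 'a \<Rightarrow> real) x. profile h \<Longrightarrow> (\<integral>\<^sup>+y. ennreal (h y) \<partial>lborel) = ennreal V \<Longrightarrow>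
      (\<integral>\<^sup>+y. \<Psi> (norm (x - y)) * ennreal (h y) \<partial>lborel) \<le> ennreal C"
    using potential_bound[OF assms(1) w\<Psi> \<Psi> V] by blast
  define a where "a = 1 / (2 * (2 * pi) ^ DIM('a))"
  have a: "0 < a" by (simp add: a_def)
  define K where "K h = (\<integral>\<^sup>+k. ennreal ((norm k)\<^sup>2 * h k) \<partial>lborel)" for h :: "'a \<Rightarrow> real"
  define J where "J h = enn2real (interaction \<Psi> h h)" for h :: "'a \<Rightarrow> real"
  have energy: "HF_energy w g = ereal a * enn2ereal (K h) - ereal (a * J h)"
    if "profile h" "AE k in lborel. g k = h k" for g h
  proof -
    have "(\<integral>\<^sup>+k. ennreal ((norm k)\<^sup>2 * g k) \<partial>lebesgue) = K h"
      unfolding nn_integral_completion K_def using that(2) by (intro nn_integral_cong_AE) auto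
    then show ?thesis
      unfolding HF_energy_def exchange_integral_eq[OF that \<Psi> w] by (simp add: a_def J_def)
  qed
  have mass': "emeasure lborel (cball (0::'a) R) = ennreal V" by (simp add: mass V_def)
  have b: "profile b" unfolding b_def by (rule profile_indicator) simp
  have b_adm: "b \<in> admissible \<rho>"
    unfolding b_def by (rule admissible_ball[OF \<open>0 \<le> \<rho>\<close> mass])
  have bV: "(\<integral>\<^sup>+x. ennreal (b x) \<partial>lborel) = ennreal V"
  proof -
    have "ennreal (b x) = indicator (cball 0 R) x" for x by (simp add: indicator_def b_def)
    then show ?thesis by (simp add: mass')
  qed
  have J: "J h \<le> J b" if h: "profile h" and hV: "(\<integral>\<^sup>+x. ennreal (h x) \<partial>lborel) = ennreal V" for h
  proof -
    have "interaction \<Psi> h h \<le> interaction \<Psi> b b"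
      unfolding b_def
      by (rule interaction_le_cball[where C = C]) (simp_all add: h hV mass' R \<Psi> anti C)
    \<comment> \<open>Needed to pass to real numbers, as \<open>enn2real\<close> sends
      \<open>top\<close> to 0 and would break monotonicity.\<close>
    moreover have "interaction \<Psi> b b < \<infinity>"
      by (rule interaction_finite[OF b \<Psi> bV]) (rule C[OF b bV])
    ultimately show ?thesis unfolding J_def by (intro enn2real_mono) auto
  qed
  have Kb: "K b < \<infinity>"
    using bathtub(2)[OF b R] bV by (simp add: K_def b_def mass')
  have le: "HF_energy w b \<le> HF_energy w g"
    and eq: "HF_energy w g \<le> HF_energy w b \<Longrightarrow> AE k in lebesgue. g k = b k" if "g \<in> admissible \<rho>" for g
  proof -
    obtain h where h: "profile h" "AE k in lborel. g k = h k"
      and hV: "(\<integral>\<^sup>+x. ennreal (h x) \<partial>lborel) = ennreal V"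
      using admissible_borel_profile[OF \<open>g \<in> admissible \<rho>\<close>] unfolding V_def by blast
    note Jh = J[OF h(1) hV]
    have hm: "(\<integral>\<^sup>+x. ennreal (h x) \<partial>lborel) = emeasure lborel (cball (0::'a) R)"
      by (simp add: hV mass')
    note tub = bathtub[OF h(1) R hm, folded b_def K_def]
    note Eg = energy[OF h]
    show "HF_energy w b \<le> HF_energy w g"
      unfolding Eg energy[OF b AE_I2[OF refl]] HF_energy_le_iff[OF a Kb]
      using tub(1) Jh by (simp add: ennreal_neg add_increasing2)
    assume *: "HF_energy w g \<le> HF_energy w b"
    \<comment> \<open>The comparison lemma is now read with \<open>g\<close> on the left, which
      requires a finite kinetic term there.\<close>
    have "K h < \<infinity>"
    proof (rule ccontr)
      assume "\<not> K h < \<infinity>"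
      then have "K h = top" by (metis infinity_ennreal_def top.not_eq_extremum)
      then have "HF_energy w g = \<infinity>" unfolding Eg using a by simp
      moreover obtain k where "K b = ennreal k" "0 \<le> k" using Kb by (cases "K b") auto
      then have "HF_energy w b < \<infinity>"
        unfolding energy[OF b AE_I2[OF refl]] by (simp add: enn2ereal_ennreal)
      ultimately show False using * by simp
    qed
    then have "K h + ennreal (J b - J h) \<le> K b + ennreal (J h - J b)"
      using * unfolding Eg energy[OF b AE_I2[OF refl]] by (simp add: HF_energy_le_iff[OF a])
    \<comment> \<open>As \<open>J h \<le> J b\<close>, the term on the right is truncated to 0 and
      the one on the left only helps; equality of the energies is thus reduced to the bathtub
      principle.\<close>
    then have "K h \<le> K b"
      using Jh by (simp add: ennreal_neg) (metis add_increasing2 order_trans order_refl zero_le le_iff_add)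
    from tub(3)[OF this] h(2) have "AE k in lborel. g k = b k"
      by eventually_elim simp
    then show "AE k in lebesgue. g k = b k" by (rule AE_completion)
  qed
  have min: "HF_energy w b = E_HF_no_spin w \<rho>"
    unfolding E_HF_no_spin_def by (intro antisym INF_greatest INF_lower le b_adm)
  show ?thesis
    unfolding gTF b_def[symmetric] is_no_spin_minimiser_def
    using b_adm min eq by auto
qed

end
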